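(* Let $a>0$ and let $V=\ell^2(\mathbb{Z}_+)$ be the $\mathfrak{osp}(1|2)$ representation space with parameter $a$. In $V$, the position operator $\hat x=\frac{b^++b^-}{\sqrt2}$ has formal eigenvectors $$v(x)=\sum_{n=0}^\infty\beta_n(x)\,e_n,$$ with eigenvalue $x$, where the coefficients are $$\beta_{2n}(x)=(-1)^n\sqrt{\frac{(a)_n}{n!}}\;\frac{|x|^{a-\frac12}e^{-x^2/2}}{\sqrt{\Gamma(a)}}\;{}_1F_1(-n;a;x^2),$$ $$\beta_{2n+1}(x)=(-1)^n\sqrt{\frac{(a+1)_n}{n!}}\;\frac{x|x|^{a-\frac12}e^{-x^2/2}}{\sqrt{\Gamma(a+1)}}\;{}_1F_1(-n;a+1;x^2).$$ The spectrum of $\hat x$ in $V$ is equal to $\mathbb{R}$, which is the support of the weight function of the generalized Hermite polynomials.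
   Context: Representation space: $V=\ell^2(\mathbb{Z}_+)$ is the Hilbert space of square-summable complex sequences with orthonormal standard basis $e_0,e_1,e_2,\dots$. For $a>0$ the positive discrete series representation of $\mathfrak{osp}(1|2)$ with parameter $a$ is given by operators $b^\pm$ acting on basis vectors by $$b^+e_{2n}=\sqrt{2(n+a)}\,e_{2n+1},\quad b^-e_{2n}=\sqrt{2n}\,e_{2n-1},\quad b^+e_{2n+1}=\sqrt{2(n+1)}\,e_{2n+2},\quad b^-e_{2n+1}=\sqrt{2(n+a)}\,e_{2n}$$ (with $b^-e_0=0$). The operator $\hat x$ acts in $V$ as an unbounded self-adjoint operator. A formal eigenvector of $\hat x$ with eigenvalue $x$ is a formal series $v(x)=\sum_n\beta_n(x)e_n$ (not necessarily in $\ell^2$) satisfying $\hat x\,v(x)=x\,v(x)$, where $\hat x$ is applied term by term and coefficients of each $e_n$ are compared. The generalized Hermite polynomials are $Q_{2n}^{(a)}(x)=(-1)^nL_n^{(a-1)}(x^2)$ and $Q_{2n+1}^{(a)}(x)=(-1)^n\,x\,L_n^{(a)}(x^2)$, with $L_n^{(\alpha)}$ the Laguerre polynomials; they are orthogonal on $\mathbb{R}$ with weight function $|x|^{2a-1}e^{-x^2}$. $(c)_n=c(c+1)\cdots(c+n-1)$ is the Pochhammer symbol, and ${}_1F_1(-n;c;z)=\sum_{k=0}^n\frac{(-n)_k}{(c)_k\,k!}z^k$. *)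

theory Defs
  imports "HOL-Analysis.Analysis"
begin

subsection \<open>Sequences and the Hilbert space of square-summable sequences\<close>

text \<open>A sequence \<open>v\<close> stands for the formal series with coefficient \<open>v n\<close> at the basis vector \<open>e n\<close>.\<close>

type_synonym cseq = "nat \<Rightarrow> complex"

definition e :: "nat \<Rightarrow> cseq" where
  "e k = (\<lambda>n. if n = k then 1 else 0)"

definition ell2 :: "cseq set" where
  "ell2 = {v. summable (\<lambda>n. (cmod (v n))\<^sup>2)}"

definition ell2_norm :: "cseq \<Rightarrow> real" where
  "ell2_norm v = sqrt (\<Sum>n. (cmod (v n))\<^sup>2)"

definition finite_seqs :: "cseq set" where
  "finite_seqs = {v. finite {n. v n \<noteq> 0}}"

subsection \<open>The discrete series representation\<close>

text \<open>
  \<open>raise_coeff a k\<close> is the coefficient of \<open>e (k + 1)\<close> in \<open>b\<^sup>+ (e k)\<close>, and \<open>lower_coeff a k\<close>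
  that of \<open>e (k - 1)\<close> in \<open>b\<^sup>- (e k)\<close>. Both operators are extended term by term to all formal series;
  the lemmas below recover their action on the basis.
\<close>

definition raise_coeff :: "real \<Rightarrow> nat \<Rightarrow> real" where
  "raise_coeff a k =
    (if even k then sqrt (2 * (real (k div 2) + a)) else sqrt (2 * (real (k div 2) + 1)))"

definition lower_coeff :: "real \<Rightarrow> nat \<Rightarrow> real" where
  "lower_coeff a k =
    (if even k then sqrt (2 * real (k div 2)) else sqrt (2 * (real (k div 2) + a)))"

definition b_plus :: "real \<Rightarrow> cseq \<Rightarrow> cseq" where
  "b_plus a v =
    (\<lambda>n. if n = 0 then 0 else complex_of_real (raise_coeff a (n - 1)) * v (n - 1))"

definition b_minus :: "real \<Rightarrow> cseq \<Rightarrow> cseq" where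
  "b_minus a v = (\<lambda>n. complex_of_real (lower_coeff a (n + 1)) * v (n + 1))"

lemma b_plus_even:
  "b_plus a (e (2 * n)) = (\<lambda>k. complex_of_real (sqrt (2 * (real n + a))) * e (2 * n + 1) k)"
  by (auto simp: b_plus_def raise_coeff_def e_def fun_eq_iff)

lemma b_plus_odd:
  "b_plus a (e (2 * n + 1)) = (\<lambda>k. complex_of_real (sqrt (2 * (real n + 1))) * e (2 * n + 2) k)"
  by (auto simp: b_plus_def raise_coeff_def e_def fun_eq_iff)

lemma b_minus_0: "b_minus a (e 0) = (\<lambda>k. 0)"
  by (auto simp: b_minus_def e_def fun_eq_iff)

lemma b_minus_even:
  "n > 0 \<Longrightarrow> b_minus a (e (2 * n)) = (\<lambda>k. complex_of_real (sqrt (2 * real n)) * e (2 * n - 1) k)"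
  by (auto simp: b_minus_def lower_coeff_def e_def fun_eq_iff)

lemma b_minus_odd:
  "b_minus a (e (2 * n + 1)) = (\<lambda>k. complex_of_real (sqrt (2 * (real n + a))) * e (2 * n) k)"
  by (auto simp: b_minus_def lower_coeff_def e_def fun_eq_iff)

definition xhat :: "real \<Rightarrow> cseq \<Rightarrow> cseq" where
  "xhat a v = (\<lambda>n. (b_plus a v n + b_minus a v n) / complex_of_real (sqrt 2))"

subsection \<open>The position operator in the Hilbert space and its spectrum\<close>

text \<open>
  As an unbounded operator, the position operator is the closure of its restriction to the linear
  span of the basis. Norm limits are limits of coefficients and each coefficient of \<open>xhat a v\<close>
  involves at most two coefficients of \<open>v\<close>, so the closure again acts as \<open>xhat a\<close>,
  and only its domain has to be specified.
\<close>

definition xhat_domain :: "real \<Rightarrow> cseq set" where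
  "xhat_domain a = {v \<in> ell2. xhat a v \<in> ell2 \<and>
     (\<exists>f :: nat \<Rightarrow> cseq. (\<forall>k. f k \<in> finite_seqs) \<and>
        (\<lambda>k. ell2_norm (\<lambda>n. f k n - v n)) \<longlonglongrightarrow> 0 \<and>
        (\<lambda>k. ell2_norm (\<lambda>n. xhat a (f k) n - xhat a v n)) \<longlonglongrightarrow> 0)}"

definition resolvent_set :: "cseq set \<Rightarrow> (cseq \<Rightarrow> cseq) \<Rightarrow> complex set" where
  "resolvent_set D T = {z.
     bij_betw (\<lambda>v n. T v n - z * v n) D ell2 \<and>
     (\<exists>C. \<forall>v\<in>D. ell2_norm v \<le> C * ell2_norm (\<lambda>n. T v n - z * v n))}"

definition spectrum :: "cseq set \<Rightarrow> (cseq \<Rightarrow> cseq) \<Rightarrow> complex set" where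
  "spectrum D T = - resolvent_set D T"

subsection \<open>Formal eigenvectors\<close>

definition formal_eigenvector :: "(cseq \<Rightarrow> cseq) \<Rightarrow> complex \<Rightarrow> cseq \<Rightarrow> bool" where
  "formal_eigenvector T z v \<longleftrightarrow> (\<forall>n. T v n = z * v n)"

text \<open>\<open>abs_powr x s\<close> is the power of \<open>\<bar>x\<bar>\<close> with exponent \<open>s\<close>, with the usual convention that
  exponent 0 gives 1 also at \<open>x = 0\<close>, where \<open>powr\<close> gives 0. For \<open>s < 0\<close> its value 0 at \<open>x = 0\<close> has no meaning.\<close>

definition abs_powr :: "real \<Rightarrow> real \<Rightarrow> real" where
  "abs_powr x s = (if s = 0 then 1 else \<bar>x\<bar> powr s)"

text \<open>The terminating series with first parameter \<open>- n\<close>.\<close>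

definition hyp1F1 :: "nat \<Rightarrow> real \<Rightarrow> real \<Rightarrow> real" where
  "hyp1F1 n c z = (\<Sum>k\<le>n. pochhammer (- real n) k / (pochhammer c k * fact k) * z ^ k)"

definition beta_even :: "real \<Rightarrow> nat \<Rightarrow> real \<Rightarrow> real" where
  "beta_even a n x = (- 1) ^ n * sqrt (pochhammer a n / fact n) *
     (abs_powr x (a - 1 / 2) * exp (- x\<^sup>2 / 2) / sqrt (Gamma a)) * hyp1F1 n a (x\<^sup>2)"

definition beta_odd :: "real \<Rightarrow> nat \<Rightarrow> real \<Rightarrow> real" where
  "beta_odd a n x = (- 1) ^ n * sqrt (pochhammer (a + 1) n / fact n) *
     (x * abs_powr x (a - 1 / 2) * exp (- x\<^sup>2 / 2) / sqrt (Gamma (a + 1))) * hyp1F1 n (a + 1) (x\<^sup>2)"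

definition eigenseries :: "real \<Rightarrow> real \<Rightarrow> cseq" where
  "eigenseries a x = (\<lambda>k. complex_of_real
     (if even k then beta_even a (k div 2) x else beta_odd a (k div 2) x))"

subsection \<open>Generalized Hermite polynomials and their weight function\<close>

definition laguerre :: "nat \<Rightarrow> real \<Rightarrow> real \<Rightarrow> real" where
  "laguerre n \<alpha> x = (\<Sum>k\<le>n. (- 1) ^ k * ((real n + \<alpha>) gchoose (n - k)) / fact k * x ^ k)"

definition gen_hermite :: "real \<Rightarrow> nat \<Rightarrow> real \<Rightarrow> real" where
  "gen_hermite a m x =
    (if even m then (- 1) ^ (m div 2) * laguerre (m div 2) (a - 1) (x\<^sup>2)
     else (- 1) ^ (m div 2) * x * laguerre (m div 2) a (x\<^sup>2))"

definition gen_hermite_weight :: "real \<Rightarrow> real \<Rightarrow> real" where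
  "gen_hermite_weight a x = abs_powr x (2 * a - 1) * exp (- x\<^sup>2)"

definition is_weight_function :: "(real \<Rightarrow> real) \<Rightarrow> (nat \<Rightarrow> real \<Rightarrow> real) \<Rightarrow> bool" where
  "is_weight_function w Q \<longleftrightarrow>
     w \<in> borel_measurable lborel \<and> (\<forall>x. 0 \<le> w x) \<and>
     (\<forall>m n. integrable lborel (\<lambda>x. Q m x * Q n x * w x)) \<and>
     (\<forall>m n. m \<noteq> n \<longrightarrow> (LINT x|lborel. Q m x * Q n x * w x) = 0) \<and>
     (\<forall>n. (LINT x|lborel. (Q n x)\<^sup>2 * w x) > 0)"

end

theory Submission
  imports Defs
begin

text \<open>
  The position operator is a Jacobi matrix whose off-diagonal entries \<open>c n\<close> satisfy
  \<open>(c n)\<^sup>2 = O(n)\<close> with bounded increments.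

  Non-real \<open>z\<close> lie in the resolvent set: Green's identity gives the lower bound \<open>\<bar>Im z\<bar>\<close>, and the
  equation \<open>(J - z) v = g\<close> is solved by truncation, a solution of the three-term recurrence being
  an affine function of its value at 0, so that a convergent subsequence of these values suffices.

  Real \<open>x\<close> lie in the spectrum: the Turan-type quantity
  \<open>(q n)\<^sup>2 + (q (n+1))\<^sup>2 - x / c n * q n * q (n+1)\<close> shows that the formal eigenvector \<open>q\<close> grows at most
  polynomially, and then the sequences \<open>q n / (n + m)^s\<close>, with \<open>s\<close> fixed and \<open>m \<longrightarrow> \<infinity>\<close>,
  are approximate eigenvectors.

  The eigenvector equation amounts to two contiguous relations of \<open>1F1\<close>, and the orthogonality to the
  vanishing of the \<open>n\<close>-th difference of a polynomial of degree less than \<open>n\<close>.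
\<close>

subsection \<open>Jacobi operators\<close>

definition jacobi_op :: "(nat \<Rightarrow> real) \<Rightarrow> cseq \<Rightarrow> cseq" where
  "jacobi_op c v n = complex_of_real (c n) * v (Suc n) +
     (if n = 0 then 0 else complex_of_real (c (n - 1)) * v (n - 1))"

lemma jacobi_op_0: "jacobi_op c v 0 = complex_of_real (c 0) * v (Suc 0)"
  by (simp add: jacobi_op_def)

lemma jacobi_op_Suc:
  "jacobi_op c v (Suc n) = complex_of_real (c (Suc n)) * v (Suc (Suc n)) + complex_of_real (c n) * v n"
  by (simp add: jacobi_op_def)

lemma jacobi_op_diff: "jacobi_op c (\<lambda>n. u n - v n) n = jacobi_op c u n - jacobi_op c v n"
  by (simp add: jacobi_op_def algebra_simps)

text \<open>Summation by parts: the matrix is real and symmetric, so in the imaginary part of the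
  truncated form the contributions of neighbouring indices cancel and only the coupling across the
  cut at \<open>N\<close> survives.\<close>

lemma jacobi_op_green:
  "Im z * (\<Sum>n\<le>N. (cmod (v n))\<^sup>2) + (\<Sum>n\<le>N. Im (cnj (v n) * (jacobi_op c v n - z * v n)))
    = c N * Im (cnj (v N) * v (Suc N))"
proof (induction N)
  case 0
  show ?case by (simp add: jacobi_op_0 cmod_def power2_eq_square algebra_simps)
next
  case (Suc N)
  have "Im z * (cmod (v (Suc N)))\<^sup>2 + Im (cnj (v (Suc N)) * (jacobi_op c v (Suc N) - z * v (Suc N)))
      = c (Suc N) * Im (cnj (v (Suc N)) * v (Suc (Suc N))) - c N * Im (cnj (v N) * v (Suc N))"
    by (simp add: jacobi_op_Suc cmod_def power2_eq_square algebra_simps)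
  with Suc show ?case by (simp add: algebra_simps)
qed

text \<open>Cauchy-Schwarz in Green's identity. In the uses below the boundary term is either small
  at suitable \<open>N\<close> or zero because \<open>v (Suc N) = 0\<close>.\<close>

lemma jacobi_op_green_bound:
  assumes "c N \<ge> 0"
  shows "\<bar>Im z\<bar> * (\<Sum>n\<le>N. (cmod (v n))\<^sup>2) \<le>
    L2_set (\<lambda>n. cmod (v n)) {..N} * L2_set (\<lambda>n. cmod (jacobi_op c v n - z * v n)) {..N}
      + c N * (cmod (v N) * cmod (v (Suc N)))"
proof -
  let ?g = "\<lambda>n. jacobi_op c v n - z * v n"
  have "\<bar>Im z\<bar> * (\<Sum>n\<le>N. (cmod (v n))\<^sup>2) = \<bar>Im z * (\<Sum>n\<le>N. (cmod (v n))\<^sup>2)\<bar>"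
    by (simp add: abs_mult sum_nonneg)
  also have "\<dots> = \<bar>c N * Im (cnj (v N) * v (Suc N)) - (\<Sum>n\<le>N. Im (cnj (v n) * ?g n))\<bar>"
    using jacobi_op_green[of z v N c] by (simp add: algebra_simps)
  also have "\<dots> \<le> c N * \<bar>Im (cnj (v N) * v (Suc N))\<bar> + \<bar>\<Sum>n\<le>N. Im (cnj (v n) * ?g n)\<bar>"
    using assms by (simp add: abs_triangle_ineq4 order_trans[OF abs_triangle_ineq4] abs_mult)
  also have "\<dots> \<le> c N * (cmod (v N) * cmod (v (Suc N))) + (\<Sum>n\<le>N. \<bar>cmod (v n)\<bar> * \<bar>cmod (?g n)\<bar>)"
  proof (intro add_mono mult_left_mono assms)
    show "\<bar>Im (cnj (v N) * v (Suc N))\<bar> \<le> cmod (v N) * cmod (v (Suc N))"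
      using abs_Im_le_cmod[of "cnj (v N) * v (Suc N)"] by (simp only: norm_mult complex_mod_cnj)
    show "\<bar>\<Sum>n\<le>N. Im (cnj (v n) * ?g n)\<bar> \<le> (\<Sum>n\<le>N. \<bar>cmod (v n)\<bar> * \<bar>cmod (?g n)\<bar>)"
    proof (rule order_trans[OF sum_abs sum_mono])
      show "\<bar>Im (cnj (v n) * ?g n)\<bar> \<le> \<bar>cmod (v n)\<bar> * \<bar>cmod (?g n)\<bar>" for n
        using abs_Im_le_cmod[of "cnj (v n) * ?g n"]
        by (simp only: norm_mult complex_mod_cnj abs_norm_cancel)
    qed
  qed
  also have "\<dots> \<le> c N * (cmod (v N) * cmod (v (Suc N)))
      + L2_set (\<lambda>n. cmod (v n)) {..N} * L2_set (\<lambda>n. cmod (?g n)) {..N}"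
    by (intro add_mono order_refl L2_set_mult_ineq)
  finally show ?thesis by (simp add: add.commute)
qed

section \<open>Square-summable sequences\<close>

lemma L2_set_le_ell2_norm:
  assumes "v \<in> ell2"
  shows "L2_set (\<lambda>n. cmod (v n)) {..N} \<le> ell2_norm v"
  using assms unfolding L2_set_def ell2_norm_def ell2_def
  by (intro real_sqrt_le_mono sum_le_suminf) auto

lemma ell2_norm_nonneg: "v \<in> ell2 \<Longrightarrow> 0 \<le> ell2_norm v"
  unfolding ell2_norm_def ell2_def by (auto intro!: suminf_nonneg)

lemma ell2_norm_sq: "v \<in> ell2 \<Longrightarrow> (ell2_norm v)\<^sup>2 = (\<Sum>n. (cmod (v n))\<^sup>2)"
  unfolding ell2_norm_def ell2_def by (auto intro!: suminf_nonneg)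

lemma ell2_norm_eq_0_D:
  assumes "v \<in> ell2" "ell2_norm v = 0"
  shows "v n = 0"
proof -
  have "cmod (v n) \<le> L2_set (\<lambda>n. cmod (v n)) {..n}"
    by (rule member_le_L2_set) auto
  also have "\<dots> \<le> 0"
    using L2_set_le_ell2_norm[OF assms(1), of n] assms(2) by simp
  finally show ?thesis by simp
qed

lemma cmod_add_sq_le: "(cmod (x + y))\<^sup>2 \<le> 2 * (cmod x)\<^sup>2 + 2 * (cmod y)\<^sup>2"
proof -
  have "(cmod (x + y))\<^sup>2 \<le> (cmod x + cmod y)\<^sup>2"
    by (intro power_mono norm_triangle_ineq) auto
  also have "\<dots> \<le> 2 * (cmod x)\<^sup>2 + 2 * (cmod y)\<^sup>2"
    using sum_squares_bound[of "cmod x" "cmod y"] by (simp add: power2_sum)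
  finally show ?thesis .
qed

lemma ell2_add: "u \<in> ell2 \<Longrightarrow> v \<in> ell2 \<Longrightarrow> (\<lambda>n. u n + v n) \<in> ell2"
  unfolding ell2_def mem_Collect_eq
  by (rule summable_comparison_test'[where g = "\<lambda>n. 2 * (cmod (u n))\<^sup>2 + 2 * (cmod (v n))\<^sup>2" and N = 0])
     (auto intro!: summable_add summable_mult cmod_add_sq_le)

lemma ell2_scale: "v \<in> ell2 \<Longrightarrow> (\<lambda>n. z * v n) \<in> ell2"
  unfolding ell2_def mem_Collect_eq by (simp add: norm_mult power_mult_distrib summable_mult)

lemma ell2_diff: "u \<in> ell2 \<Longrightarrow> v \<in> ell2 \<Longrightarrow> (\<lambda>n. u n - v n) \<in> ell2"
  using ell2_add[of u "\<lambda>n. (-1) * v n"] ell2_scale[of v "-1"] by simp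

text \<open>Otherwise \<open>u\<close> would eventually dominate a multiple of the harmonic series.
  Summability does not force \<open>n * u n\<close> to tend to 0, but good indices beyond every
  bound are enough for truncation.\<close>

lemma summable_imp_small_index:
  fixes u :: "nat \<Rightarrow> real"
  assumes "summable u" "\<epsilon> > 0"
  shows "\<exists>n\<ge>M. real (Suc n) * u n < \<epsilon>"
proof (rule ccontr)
  assume "\<not> ?thesis"
  hence *: "\<epsilon> \<le> real (Suc n) * u n" if "n \<ge> M" for n
    using that by (metis not_le)
  have "summable (\<lambda>n. inverse (real (Suc n)))"
  proof (rule summable_comparison_test'[where g = "\<lambda>n. (1 / \<epsilon>) * u n" and N = M])
    show "summable (\<lambda>n. (1 / \<epsilon>) * u n)" by (intro summable_mult assms)
    show "norm (inverse (real (Suc n))) \<le> (1 / \<epsilon>) * u n" if "n \<ge> M" for n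
      using *[OF that] assms(2) by (simp add: field_simps)
  qed
  hence "summable (\<lambda>n. inverse (real n))"
    by (subst (asm) summable_Suc_iff)
  thus False using not_summable_harmonic[where 'a = real] by (simp add: inverse_eq_divide)
qed

text \<open>The solution of \<open>(J - z) v = g\<close> with \<open>v 0 = t\<close>.\<close>

fun jacobi_sol :: "(nat \<Rightarrow> real) \<Rightarrow> cseq \<Rightarrow> complex \<Rightarrow> complex \<Rightarrow> nat \<Rightarrow> complex" where
  "jacobi_sol c g z t 0 = t"
| "jacobi_sol c g z t (Suc 0) = (g 0 + z * t) / complex_of_real (c 0)"
| "jacobi_sol c g z t (Suc (Suc n)) =
     (g (Suc n) + z * jacobi_sol c g z t (Suc n) - complex_of_real (c n) * jacobi_sol c g z t n)
       / complex_of_real (c (Suc n))"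

lemma jacobi_sol_affine:
  "jacobi_sol c g z t n = jacobi_sol c g z 0 n + t * jacobi_sol c (\<lambda>_. 0) z 1 n"
proof (induction n rule: induct_nat_012)
  case (ge2 n)
  show ?case
    unfolding jacobi_sol.simps(3) ge2.IH(1) ge2.IH(2)
    by (simp add: add_divide_distrib diff_divide_distrib algebra_simps)
qed (simp_all add: add_divide_distrib)

text \<open>Slow variation of the damping factor \<open>1 / y ^ s\<close>: Bernoulli's inequality at
  \<open>- 1 / (y + 1)\<close> controls the relative increment, and \<open>y + 1 \<le> 2 * y\<close>
  compares neighbouring values.\<close>

lemma inverse_power_diff:
  fixes y :: real
  assumes "y \<ge> 1"
  shows "\<bar>1 / (y + 1) ^ s - 1 / y ^ s\<bar> \<le> real s / (y + 1) * (1 / y ^ s)"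
    and "1 / y ^ s \<le> 2 ^ s * (1 / (y + 1) ^ s)"
proof -
  have "1 + real s * (- 1 / (y + 1)) \<le> (1 + (- 1 / (y + 1))) ^ s"
    using assms by (intro Bernoulli_inequality) (simp add: field_simps)
  also have "1 + (- 1 / (y + 1)) = y / (y + 1)" using assms by (simp add: field_simps)
  finally have "1 - real s / (y + 1) \<le> y ^ s / (y + 1) ^ s" by (simp add: power_divide)
  hence "(1 - real s / (y + 1)) * (1 / y ^ s) \<le> y ^ s / (y + 1) ^ s * (1 / y ^ s)"
    using assms by (intro mult_right_mono) auto
  hence "1 / y ^ s - real s / (y + 1) * (1 / y ^ s) \<le> 1 / (y + 1) ^ s"
    by (simp only: left_diff_distrib) (use assms in simp)
  moreover have "1 / (y + 1) ^ s \<le> 1 / y ^ s"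
    using assms by (intro divide_left_mono power_mono mult_pos_pos) auto
  ultimately show "\<bar>1 / (y + 1) ^ s - 1 / y ^ s\<bar> \<le> real s / (y + 1) * (1 / y ^ s)" by linarith
  have "(y + 1) ^ s \<le> (2 * y) ^ s" using assms by (intro power_mono) auto
  thus "1 / y ^ s \<le> 2 ^ s * (1 / (y + 1) ^ s)"
    using assms by (simp add: field_simps power_mult_distrib)
qed

section \<open>Off-diagonal entries growing at most like the square root of \<open>n\<close>:
  non-real spectral parameters and the domain\<close>

locale jacobi =
  fixes c :: "nat \<Rightarrow> real" and K :: real
  assumes c_pos: "c n > 0"
    and c_sq_le: "(c n)\<^sup>2 \<le> K * real (Suc n)"
begin

lemma K_pos: "K > 0"
proof -
  have "0 < (c 0)\<^sup>2" using c_pos[of 0] by simp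
  also have "\<dots> \<le> K" using c_sq_le[of 0] by simp
  finally show ?thesis .
qed

lemma jacobi_op_sol:
  "jacobi_op c (jacobi_sol c g z t) n - z * jacobi_sol c g z t n = g n"
  using c_pos by (cases n) (auto simp: jacobi_op_0 jacobi_op_Suc less_imp_neq[symmetric])

text \<open>To be paired with \<open>c_sq_le\<close>: up to constants the factor
  \<open>real (Suc n)\<close> dominates \<open>(c n)\<^sup>2\<close>, and also \<open>c n\<close>,
  so the terms created by truncating at \<open>n\<close> are small.\<close>

lemma boundary_small:
  assumes "v \<in> ell2" "\<epsilon> > 0"
  shows "\<exists>n\<ge>M. real (Suc n) * ((cmod (v n))\<^sup>2 + (cmod (v (Suc n)))\<^sup>2) < \<epsilon>"
  by (rule summable_imp_small_index)
     (use assms in \<open>auto intro!: summable_add simp: ell2_def summable_Suc_iff[of "\<lambda>n. (cmod (v n))\<^sup>2"]\<close>)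

text \<open>Since \<open>v\<close> need not have finite support, Green's identity is applied at the
  cuts supplied by \<open>boundary_small\<close>. The slack \<epsilon> and the truncation are then
  removed, and one factor \<open>ell2_norm v\<close> is cancelled.\<close>

lemma lower_bound_nonreal:
  assumes v: "v \<in> ell2" and g: "(\<lambda>n. jacobi_op c v n - z * v n) \<in> ell2"
  shows "\<bar>Im z\<bar> * ell2_norm v \<le> ell2_norm (\<lambda>n. jacobi_op c v n - z * v n)"
proof -
  let ?G = "ell2_norm (\<lambda>n. jacobi_op c v n - z * v n)"
  have part: "\<bar>Im z\<bar> * (\<Sum>n\<le>M. (cmod (v n))\<^sup>2) \<le> ell2_norm v * ?G + \<epsilon>" if "\<epsilon> > 0" for M \<epsilon>
  proof -
    \<comment> \<open>The bound \<open>c N \<le> (1 + K) * real (Suc N)\<close> below turns this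
      threshold into a boundary term of at most \<epsilon>.\<close>
    have "\<epsilon> / (1 + K) > 0" using that K_pos by simp
    from boundary_small[OF v this] obtain N where N: "N \<ge> M"
      "real (Suc N) * ((cmod (v N))\<^sup>2 + (cmod (v (Suc N)))\<^sup>2) < \<epsilon> / (1 + K)"
      by blast
    have "c N \<le> 1 + (c N)\<^sup>2"
      using sum_squares_bound[of "c N" 1] c_pos[of N] by simp
    also have "\<dots> \<le> (1 + K) * real (Suc N)"
      using c_sq_le[of N] by (simp add: algebra_simps)
    finally have cN: "c N \<le> (1 + K) * real (Suc N)" .
    have "cmod (v N) * cmod (v (Suc N)) \<le> (cmod (v N))\<^sup>2 + (cmod (v (Suc N)))\<^sup>2"
      using sum_squares_bound[of "cmod (v N)" "cmod (v (Suc N))"]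
        mult_nonneg_nonneg[of "cmod (v N)" "cmod (v (Suc N))", OF norm_ge_zero norm_ge_zero] by linarith
    hence "c N * (cmod (v N) * cmod (v (Suc N)))
        \<le> ((1 + K) * real (Suc N)) * ((cmod (v N))\<^sup>2 + (cmod (v (Suc N)))\<^sup>2)"
      using cN c_pos[of N] K_pos by (intro mult_mono) auto
    also have "\<dots> \<le> \<epsilon>"
      using N(2) K_pos by (simp add: field_simps)
    finally have bd: "c N * (cmod (v N) * cmod (v (Suc N))) \<le> \<epsilon>" .
    have "\<bar>Im z\<bar> * (\<Sum>n\<le>M. (cmod (v n))\<^sup>2) \<le> \<bar>Im z\<bar> * (\<Sum>n\<le>N. (cmod (v n))\<^sup>2)"
      using N(1) by (intro mult_left_mono sum_mono2) auto
    also have "\<dots> \<le> L2_set (\<lambda>n. cmod (v n)) {..N} * L2_set (\<lambda>n. cmod (jacobi_op c v n - z * v n)) {..N}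
      + c N * (cmod (v N) * cmod (v (Suc N)))"
      by (rule jacobi_op_green_bound) (use c_pos[of N] in simp)
    also have "\<dots> \<le> ell2_norm v * ?G + \<epsilon>"
      by (intro add_mono mult_mono L2_set_le_ell2_norm v g bd ell2_norm_nonneg L2_set_nonneg)
    finally show ?thesis .
  qed
  have "\<bar>Im z\<bar> * (\<Sum>n\<le>M. (cmod (v n))\<^sup>2) \<le> ell2_norm v * ?G" for M
    by (rule field_le_epsilon) (rule part)
  moreover have "(\<lambda>M. \<Sum>n\<le>M. (cmod (v n))\<^sup>2) \<longlonglongrightarrow> (\<Sum>n. (cmod (v n))\<^sup>2)"
    using v by (auto simp: ell2_def intro: summable_LIMSEQ')
  hence "(\<lambda>M. \<bar>Im z\<bar> * (\<Sum>n\<le>M. (cmod (v n))\<^sup>2)) \<longlonglongrightarrow> \<bar>Im z\<bar> * (ell2_norm v)\<^sup>2"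
    unfolding ell2_norm_sq[OF v] by (intro tendsto_mult_left)
  ultimately have "\<bar>Im z\<bar> * (ell2_norm v)\<^sup>2 \<le> ell2_norm v * ?G"
    using LIMSEQ_le_const2 by blast
  hence "ell2_norm v * (\<bar>Im z\<bar> * ell2_norm v) \<le> ell2_norm v * ?G"
    by (simp add: power2_eq_square algebra_simps)
  thus ?thesis
    using ell2_norm_nonneg[OF v] ell2_norm_nonneg[OF g]
    by (cases "ell2_norm v = 0") auto
qed

lemma surjective_nonreal:
  assumes z: "Im z \<noteq> 0" and g: "g \<in> ell2"
  shows "\<exists>v\<in>ell2. \<forall>n. jacobi_op c v n - z * v n = g n"
proof -
  define q where "q = jacobi_sol c (\<lambda>_. 0) z 1"
  define p where "p = jacobi_sol c g z 0"
  \<comment> \<open>A zero of the homogeneous solution at \<open>Suc N\<close> removes the boundary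
    term, and Green's identity with \<open>Im z \<noteq> 0\<close> then forces
    \<open>q 0 = 0\<close>, against the initial value 1.\<close>
  have q_nz: "q (Suc N) \<noteq> 0" for N
  proof
    assume "q (Suc N) = 0"
    hence "Im z * (\<Sum>n\<le>N. (cmod (q n))\<^sup>2) = 0"
      using jacobi_op_green[of z q N c] by (simp add: q_def jacobi_op_sol)
    hence "(\<Sum>n\<le>N. (cmod (q n))\<^sup>2) = 0" using z by simp
    hence "q 0 = 0" by (subst (asm) sum_nonneg_eq_0_iff) auto
    thus False by (simp add: q_def)
  qed
  \<comment> \<open>\<open>V N\<close> is the solution vanishing at \<open>N + 1\<close>, so that Green's identity up to \<open>N\<close> has no boundary term.\<close>
  define t where "t N = - p (Suc N) / q (Suc N)" for N
  define V where "V N = jacobi_sol c g z (t N)" for N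
  have V_eq: "V N n = p n + t N * q n" for N n
    unfolding V_def p_def q_def by (rule jacobi_sol_affine)
  have V_bound: "L2_set (\<lambda>n. cmod (V N n)) {..N} \<le> ell2_norm g / \<bar>Im z\<bar>" for N
  proof -
    let ?L = "L2_set (\<lambda>n. cmod (V N n)) {..N}"
    have "V N (Suc N) = 0" using q_nz[of N] by (simp add: V_eq t_def)
    hence "\<bar>Im z\<bar> * (\<Sum>n\<le>N. (cmod (V N n))\<^sup>2) \<le> ?L * L2_set (\<lambda>n. cmod (g n)) {..N}"
      using jacobi_op_green_bound[of c N z "V N"] c_pos[of N] by (simp add: V_def jacobi_op_sol)
    also have "\<dots> \<le> ?L * ell2_norm g"
      by (intro mult_left_mono L2_set_le_ell2_norm g L2_set_nonneg)
    finally have "?L * (\<bar>Im z\<bar> * ?L) \<le> ?L * ell2_norm g"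
      by (simp add: L2_set_def sum_nonneg algebra_simps)
    hence "\<bar>Im z\<bar> * ?L \<le> ell2_norm g"
      using L2_set_nonneg[of "\<lambda>n. cmod (V N n)" "{..N}"] ell2_norm_nonneg[OF g]
      by (cases "?L = 0") auto
    thus ?thesis using z by (simp add: field_simps)
  qed
  \<comment> \<open>The initial value \<open>t N\<close> is the coordinate \<open>V N 0\<close>, so
    the uniform norm bound also bounds it.\<close>
  have "cmod (t N) \<le> ell2_norm g / \<bar>Im z\<bar>" for N
    using V_bound[of N] member_le_L2_set[of "{..N}" 0 "\<lambda>n. cmod (V N n)"] by (simp add: V_def)
  hence "bounded (range t)" by (auto intro!: boundedI)
  then obtain l r where r: "strict_mono r" and lim: "(t \<circ> r) \<longlonglongrightarrow> l"
    using bounded_imp_convergent_subsequence by blast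
  define v where "v = jacobi_sol c g z l"
  have v_eq: "v n = p n + l * q n" for n
    unfolding v_def p_def q_def by (rule jacobi_sol_affine)
  have lim_V: "(\<lambda>k. V (r k) n) \<longlonglongrightarrow> v n" for n
    unfolding V_eq v_eq using lim by (intro tendsto_intros) (simp add: o_def)
  \<comment> \<open>For fixed \<open>M\<close> the cuts \<open>r k\<close> eventually pass
    \<open>M\<close>, so the bound, uniform in \<open>k\<close>, survives the coordinatewise
    limit.\<close>
  have "(\<Sum>n\<le>M. (cmod (v n))\<^sup>2) \<le> (ell2_norm g / \<bar>Im z\<bar>)\<^sup>2" for M
  proof (rule LIMSEQ_le_const2)
    show "(\<lambda>k. \<Sum>n\<le>M. (cmod (V (r k) n))\<^sup>2) \<longlonglongrightarrow> (\<Sum>n\<le>M. (cmod (v n))\<^sup>2)"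
      by (intro tendsto_intros lim_V)
    have "(\<Sum>n\<le>M. (cmod (V (r k) n))\<^sup>2) \<le> (ell2_norm g / \<bar>Im z\<bar>)\<^sup>2" if "k \<ge> M" for k
    proof -
      have "M \<le> r k" using seq_suble[OF r, of k] that by simp
      hence "(\<Sum>n\<le>M. (cmod (V (r k) n))\<^sup>2) \<le> (\<Sum>n\<le>r k. (cmod (V (r k) n))\<^sup>2)"
        by (intro sum_mono2) auto
      also have "\<dots> = (L2_set (\<lambda>n. cmod (V (r k) n)) {..r k})\<^sup>2"
        by (simp add: L2_set_def sum_nonneg)
      also have "\<dots> \<le> (ell2_norm g / \<bar>Im z\<bar>)\<^sup>2"
        by (intro power_mono V_bound L2_set_nonneg)
      finally show ?thesis .
    qed
    thus "\<exists>N. \<forall>k\<ge>N. (\<Sum>n\<le>M. (cmod (V (r k) n))\<^sup>2) \<le> (ell2_norm g / \<bar>Im z\<bar>)\<^sup>2" by blast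
  qed
  hence "summable (\<lambda>n. (cmod (v n))\<^sup>2)"
    by (intro bounded_imp_summable) auto
  hence "v \<in> ell2" by (simp add: ell2_def)
  thus ?thesis using jacobi_op_sol[of g z l] unfolding v_def by blast
qed

text \<open>The finite sequences are a core of the maximal operator. Hence membership in the domain
  of the closure reduces to square-summability of \<open>v\<close> and of its image, which is easy
  to check for the vectors constructed in the spectral argument.\<close>

lemma maximal_domain_core:
  assumes v: "v \<in> ell2" and h: "jacobi_op c v \<in> ell2"
  shows "\<exists>f. (\<forall>k. f k \<in> finite_seqs) \<and>
     (\<lambda>k. ell2_norm (\<lambda>n. f k n - v n)) \<longlonglongrightarrow> 0 \<and>
     (\<lambda>k. ell2_norm (\<lambda>n. jacobi_op c (f k) n - jacobi_op c v n)) \<longlonglongrightarrow> 0"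
proof -
  let ?u = "\<lambda>n. (cmod (v n))\<^sup>2 + (cmod (v (Suc n)))\<^sup>2"
  define h where "h = jacobi_op c v"
  \<comment> \<open>Cutting \<open>v\<close> off after \<open>N\<close> creates an error of size \<open>(c N)\<^sup>2 * ?u N\<close>, which is small for suitable large \<open>N\<close>.\<close>
  have "\<exists>n\<ge>k. real (Suc n) * ?u n < 1 / real (Suc k)" for k
    by (rule boundary_small[OF v]) simp
  then obtain N where N_ge: "\<And>k. N k \<ge> k" and N_small: "\<And>k. real (Suc (N k)) * ?u (N k) < 1 / real (Suc k)"
    by metis
  define f where "f k n = (if n \<le> N k then v n else 0)" for k n
  have N_lim: "filterlim N sequentially sequentially"
    by (rule filterlim_at_top_mono[OF filterlim_ident]) (simp add: N_ge)
  have tail: "(\<lambda>k. \<Sum>n. if n \<le> N k then 0 else (cmod (y n))\<^sup>2) \<longlonglongrightarrow> 0"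
    and tail_summable: "summable (\<lambda>n. if n \<le> N k then 0 else (cmod (y n))\<^sup>2)"
    if "y \<in> ell2" for y k
  proof -
    have y: "summable (\<lambda>n. (cmod (y n))\<^sup>2)" using that by (simp add: ell2_def)
    have sums: "(\<lambda>n. if n \<le> N k then 0 else (cmod (y n))\<^sup>2) sums ((\<Sum>n. (cmod (y n))\<^sup>2) - (\<Sum>n\<le>N k. (cmod (y n))\<^sup>2))" for k
    proof -
      have "(\<lambda>n. if n \<in> {..N k} then (cmod (y n))\<^sup>2 else 0) sums (\<Sum>n\<le>N k. (cmod (y n))\<^sup>2)"
        by (rule sums_If_finite_set) simp
      from sums_diff[OF summable_sums[OF y] this] show ?thesis
        by (rule sums_cong[THEN iffD1, rotated]) auto
    qed
    show "summable (\<lambda>n. if n \<le> N k then 0 else (cmod (y n))\<^sup>2)" using sums by (rule sums_summable)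
    have "(\<lambda>k. \<Sum>n\<le>N k. (cmod (y n))\<^sup>2) \<longlonglongrightarrow> (\<Sum>n. (cmod (y n))\<^sup>2)"
      using filterlim_compose[OF summable_LIMSEQ'[OF y] N_lim] .
    from tendsto_diff[OF tendsto_const[of "\<Sum>n. (cmod (y n))\<^sup>2"] this]
    show "(\<lambda>k. \<Sum>n. if n \<le> N k then 0 else (cmod (y n))\<^sup>2) \<longlonglongrightarrow> 0"
      by (simp add: sums_unique[OF sums, symmetric])
  qed
  have fin: "f k \<in> finite_seqs" for k
    unfolding finite_seqs_def by (auto simp: f_def intro!: finite_subset[of _ "{..N k}"])
  have lim1: "(\<lambda>k. ell2_norm (\<lambda>n. f k n - v n)) \<longlonglongrightarrow> 0"
  proof -
    have "ell2_norm (\<lambda>n. f k n - v n) = sqrt (\<Sum>n. if n \<le> N k then 0 else (cmod (v n))\<^sup>2)" for k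
      unfolding ell2_norm_def by (intro arg_cong[where f = sqrt] suminf_cong) (simp add: f_def)
    thus ?thesis using tendsto_real_sqrt[OF tail[OF v]] by simp
  qed
  have lim2: "(\<lambda>k. ell2_norm (\<lambda>n. jacobi_op c (f k) n - h n)) \<longlonglongrightarrow> 0"
  proof -
    \<comment> \<open>A summable majorant of the squared error. Below the cut there is no error;
      beyond \<open>Suc (N k)\<close> the error is the tail of \<open>h\<close>; at the two indices
      next to the cut one coupling with coefficient \<open>c (N k)\<close> is lost or left over. The
      factors 2 come from \<open>cmod_add_sq_le\<close>.\<close>
    define D where "D k n = 2 * (if n \<le> N k then 0 else (cmod (h n))\<^sup>2) +
      (if n \<in> {N k, Suc (N k)} then 2 * K * real (Suc (N k)) * ?u (N k) else 0)" for k n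
    have D_ge: "(cmod (jacobi_op c (f k) n - h n))\<^sup>2 \<le> D k n" for k n
    proof -
      let ?N = "N k"
      have bd: "(c ?N)\<^sup>2 * y \<le> K * real (Suc ?N) * ?u ?N" if "y \<le> ?u ?N" "0 \<le> y" for y
        using that c_sq_le[of ?N] K_pos by (intro mult_mono) auto
      have nn: "0 \<le> K * real (Suc ?N) * ?u ?N" using K_pos by (intro mult_nonneg_nonneg) auto
      consider "n < ?N" | "n = ?N" | "n = Suc ?N" | "n > Suc ?N" by linarith
      then show ?thesis
      proof cases
        case 1
        then show ?thesis using nn by (simp add: jacobi_op_def h_def f_def D_def)
      next
        case 2
        hence "jacobi_op c (f k) n - h n = - complex_of_real (c ?N) * v (Suc ?N)"
          by (simp add: jacobi_op_def h_def f_def)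
        hence "(cmod (jacobi_op c (f k) n - h n))\<^sup>2 = (c ?N)\<^sup>2 * (cmod (v (Suc ?N)))\<^sup>2"
          by (simp add: norm_mult power_mult_distrib)
        also have "\<dots> \<le> K * real (Suc ?N) * ?u ?N" by (rule bd) auto
        also have "\<dots> \<le> D k n" using 2 nn by (simp add: D_def)
        finally show ?thesis .
      next
        case 3
        hence "jacobi_op c (f k) n - h n = complex_of_real (c ?N) * v ?N + (- h n)"
          by (simp add: jacobi_op_def f_def)
        hence "(cmod (jacobi_op c (f k) n - h n))\<^sup>2
            \<le> 2 * (cmod (complex_of_real (c ?N) * v ?N))\<^sup>2 + 2 * (cmod (- h n))\<^sup>2"
          by (metis cmod_add_sq_le)
        also have "\<dots> = 2 * ((c ?N)\<^sup>2 * (cmod (v ?N))\<^sup>2) + 2 * (cmod (h n))\<^sup>2"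
          by (simp add: norm_mult power_mult_distrib)
        also have "\<dots> \<le> 2 * (K * real (Suc ?N) * ?u ?N) + 2 * (cmod (h n))\<^sup>2"
          using bd[of "(cmod (v ?N))\<^sup>2"] by simp
        also have "\<dots> = D k n" using 3 by (simp add: D_def)
        finally show ?thesis .
      next
        case 4
        then show ?thesis by (simp add: jacobi_op_def f_def D_def)
      qed
    qed
    have D_sums: "D k sums (2 * (\<Sum>n. if n \<le> N k then 0 else (cmod (h n))\<^sup>2)
        + 4 * K * (real (Suc (N k)) * ?u (N k)))" for k
    proof -
      have "(\<lambda>n. if n \<in> {N k, Suc (N k)} then 2 * K * real (Suc (N k)) * ?u (N k) else 0)
          sums (\<Sum>n\<in>{N k, Suc (N k)}. 2 * K * real (Suc (N k)) * ?u (N k))"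
        by (rule sums_If_finite_set) simp
      also have "(\<Sum>n\<in>{N k, Suc (N k)}. 2 * K * real (Suc (N k)) * ?u (N k)) = 4 * K * (real (Suc (N k)) * ?u (N k))"
        by simp
      finally show ?thesis
        unfolding D_def by (intro sums_add sums_mult summable_sums tail_summable) (use assms(2) h_def in simp_all)
    qed
    have le: "(\<Sum>n. (cmod (jacobi_op c (f k) n - h n))\<^sup>2)
        \<le> 2 * (\<Sum>n. if n \<le> N k then 0 else (cmod (h n))\<^sup>2) + 4 * K * (1 / real (Suc k))"
      and nonneg: "0 \<le> (\<Sum>n. (cmod (jacobi_op c (f k) n - h n))\<^sup>2)" for k
    proof -
      have s: "summable (\<lambda>n. (cmod (jacobi_op c (f k) n - h n))\<^sup>2)"
        by (rule summable_comparison_test'[OF sums_summable[OF D_sums[of k]], of 0]) (use D_ge in simp)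
      thus "0 \<le> (\<Sum>n. (cmod (jacobi_op c (f k) n - h n))\<^sup>2)" by (rule suminf_nonneg) simp
      have "(\<Sum>n. (cmod (jacobi_op c (f k) n - h n))\<^sup>2) \<le> suminf (D k)"
        by (rule suminf_le[OF D_ge s sums_summable[OF D_sums]])
      also have "\<dots> = 2 * (\<Sum>n. if n \<le> N k then 0 else (cmod (h n))\<^sup>2)
        + 4 * K * (real (Suc (N k)) * ?u (N k))" by (rule sums_unique[OF D_sums, symmetric])
      also have "\<dots> \<le> 2 * (\<Sum>n. if n \<le> N k then 0 else (cmod (h n))\<^sup>2) + 4 * K * (1 / real (Suc k))"
        using N_small[of k] K_pos by (intro add_left_mono mult_left_mono) auto
      finally show "(\<Sum>n. (cmod (jacobi_op c (f k) n - h n))\<^sup>2)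
        \<le> 2 * (\<Sum>n. if n \<le> N k then 0 else (cmod (h n))\<^sup>2) + 4 * K * (1 / real (Suc k))" .
    qed
    have "(\<lambda>k. 2 * (\<Sum>n. if n \<le> N k then 0 else (cmod (h n))\<^sup>2) + 4 * K * (1 / real (Suc k))) \<longlonglongrightarrow> 2 * 0 + 4 * K * 0"
      using assms(2) by (intro tendsto_intros tail LIMSEQ_Suc[OF lim_1_over_n]) (simp add: h_def)
    hence "(\<lambda>k. \<Sum>n. (cmod (jacobi_op c (f k) n - h n))\<^sup>2) \<longlonglongrightarrow> 0"
      using tendsto_sandwich[OF always_eventually[OF allI[OF nonneg]] always_eventually[OF allI[OF le]] tendsto_const]
      by simp
    from tendsto_real_sqrt[OF this] show ?thesis by (simp add: ell2_norm_def)
  qed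
  show ?thesis using fin lim1 lim2 unfolding h_def by blast
qed

end

section \<open>Real spectral parameters: polynomial growth and approximate eigenvectors\<close>

locale regular_jacobi = jacobi +
  fixes \<kappa> B :: real
  assumes \<kappa>_pos: "\<kappa> > 0"
    and c_sq_ge: "\<kappa> * real (Suc n) \<le> (c n)\<^sup>2"
    and c_sq_diff: "\<bar>(c (Suc n))\<^sup>2 - (c n)\<^sup>2\<bar> \<le> B"
begin

text \<open>For constant \<open>c\<close> the quantity \<open>E\<close> below is an exact invariant
  of the recurrence. In general the bounded increments of \<open>(c n)\<^sup>2\<close>, divided by
  its linear lower bound, change \<open>E\<close> by a relative amount of order \<open>1 / n\<close>
  per step, and the product of such factors is polynomial.\<close>

lemma polynomial_growth:
  fixes q :: "nat \<Rightarrow> real" and x :: real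
  assumes rec: "\<And>n. c (Suc n) * q (Suc (Suc n)) + c n * q n = x * q (Suc n)"
  shows "\<exists>C L. \<forall>n. (q n)\<^sup>2 \<le> C * real (n + 2) ^ L"
proof -
  define E where "E n = (q n)\<^sup>2 + (q (Suc n))\<^sup>2 - x / c n * (q n * q (Suc n))" for n
  have E_step: "E (Suc n) - E n = ((c (Suc n))\<^sup>2 - (c n)\<^sup>2) / (c (Suc n))\<^sup>2 * ((q (Suc n))\<^sup>2 - E n)" for n
  proof -
    have c: "c n \<noteq> 0" "c (Suc n) \<noteq> 0" using c_pos by (simp_all add: less_imp_neq[symmetric])
    have q2: "q (Suc (Suc n)) = (x * q (Suc n) - c n * q n) / c (Suc n)"
      using rec[of n] c by (simp add: field_simps)
    show ?thesis
      unfolding E_def q2 using c by (simp add: field_simps power2_eq_square)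
  qed
  \<comment> \<open>From \<open>n0\<close> on, \<open>\<bar>x\<bar> \<le> c n\<close>, so the mixed
    term of \<open>E\<close> is at most half the sum of squares and \<open>E\<close> controls both
    squares.\<close>
  obtain n0 where n0: "x\<^sup>2 / \<kappa> \<le> real n0" using real_arch_simple by blast
  have E_ge: "(q n)\<^sup>2 + (q (Suc n))\<^sup>2 \<le> 2 * E n" if "n \<ge> n0" for n
  proof -
    have "x\<^sup>2 \<le> \<kappa> * real n0" using n0 \<kappa>_pos by (simp add: field_simps)
    also have "\<dots> \<le> \<kappa> * real (Suc n)" using that \<kappa>_pos by (intro mult_left_mono) auto
    finally have "x\<^sup>2 \<le> \<kappa> * real (Suc n)" .
    hence "\<bar>x\<bar>\<^sup>2 \<le> (c n)\<^sup>2" using c_sq_ge[of n] by simp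
    hence xc: "\<bar>x\<bar> \<le> c n" using c_pos[of n] by (meson less_imp_le power2_le_imp_le)
    have "x / c n * (q n * q (Suc n)) \<le> \<bar>x / c n\<bar> * \<bar>q n * q (Suc n)\<bar>"
      by (metis abs_ge_self abs_mult)
    also have "\<dots> \<le> 1 * \<bar>q n * q (Suc n)\<bar>"
      using xc c_pos[of n] by (intro mult_right_mono) (auto simp: divide_simps)
    also have "\<dots> \<le> ((q n)\<^sup>2 + (q (Suc n))\<^sup>2) / 2"
      using sum_squares_bound[of "\<bar>q n\<bar>" "\<bar>q (Suc n)\<bar>"] by (simp add: abs_mult)
    finally show ?thesis by (simp add: E_def)
  qed
  have E_nonneg: "0 \<le> E n" if "n \<ge> n0" for n
    using E_ge[OF that] zero_le_power2[of "q n"] zero_le_power2[of "q (Suc n)"] by linarith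
  \<comment> \<open>Rounding \<open>B / \<kappa>\<close> up to a natural number allows Bernoulli's
    inequality to bound each growth factor by \<open>((n + 3) / (n + 2)) ^ L\<close>; these factors
    telescope.\<close>
  obtain L :: nat where L: "B / \<kappa> \<le> real L" using real_arch_simple by blast
  have E_le: "E (Suc n) \<le> (real (n + 3) / real (n + 2)) ^ L * E n" if "n \<ge> n0" for n
  proof -
    \<comment> \<open>Here \<open>0 \<le> (q (Suc n))\<^sup>2 \<le> 2 * E n\<close>.\<close>
    have "\<bar>(q (Suc n))\<^sup>2 - E n\<bar> \<le> E n"
      using E_ge[OF that] zero_le_power2[of "q n"] zero_le_power2[of "q (Suc n)"] by linarith
    moreover have "\<bar>((c (Suc n))\<^sup>2 - (c n)\<^sup>2) / (c (Suc n))\<^sup>2\<bar> \<le> real L / real (n + 2)"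
    proof -
      have B0: "0 \<le> B" using c_sq_diff[of n] by linarith
      have "\<bar>((c (Suc n))\<^sup>2 - (c n)\<^sup>2) / (c (Suc n))\<^sup>2\<bar> = \<bar>(c (Suc n))\<^sup>2 - (c n)\<^sup>2\<bar> / (c (Suc n))\<^sup>2"
        by simp
      also have "\<dots> \<le> B / (\<kappa> * real (Suc (Suc n)))"
        using c_sq_diff[of n] c_sq_ge[of "Suc n"] \<kappa>_pos by (intro frac_le B0) auto
      also have "\<dots> = (B / \<kappa>) / real (n + 2)" by simp
      also have "\<dots> \<le> real L / real (n + 2)" using L by (intro divide_right_mono) auto
      finally show ?thesis .
    qed
    ultimately have "\<bar>((c (Suc n))\<^sup>2 - (c n)\<^sup>2) / (c (Suc n))\<^sup>2\<bar> * \<bar>(q (Suc n))\<^sup>2 - E n\<bar>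
        \<le> real L / real (n + 2) * E n"
      by (intro mult_mono) auto
    hence "\<bar>E (Suc n) - E n\<bar> \<le> real L / real (n + 2) * E n"
      by (simp only: E_step abs_mult)
    hence "E (Suc n) - E n \<le> real L / real (n + 2) * E n" by linarith
    hence "E (Suc n) \<le> (1 + real L * (1 / real (n + 2))) * E n"
      by (simp add: algebra_simps)
    also have "\<dots> \<le> (1 + 1 / real (n + 2)) ^ L * E n"
    proof (rule mult_right_mono[OF _ E_nonneg[OF that]])
      have "- 1 \<le> 1 / real (n + 2)" by (rule order_trans[of _ 0]) auto
      thus "1 + real L * (1 / real (n + 2)) \<le> (1 + 1 / real (n + 2)) ^ L"
        by (rule Bernoulli_inequality)
    qed
    also have "1 + 1 / real (n + 2) = real (n + 3) / real (n + 2)"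
      by (simp add: field_simps)
    finally show ?thesis .
  qed
  have E_bound: "E n \<le> E n0 * real (n + 2) ^ L" if "n \<ge> n0" for n
    using that
  proof (induction n rule: dec_induct)
    case base
    have "(1::real) \<le> real (n0 + 2) ^ L" by (intro one_le_power) simp
    thus ?case using E_nonneg[of n0] mult_left_mono[of 1 "real (n0 + 2) ^ L" "E n0"] by simp
  next
    case (step n)
    have "E (Suc n) \<le> (real (n + 3) / real (n + 2)) ^ L * E n" using step by (intro E_le)
    also have "\<dots> \<le> (real (n + 3) / real (n + 2)) ^ L * (E n0 * real (n + 2) ^ L)"
      using step by (intro mult_left_mono) auto
    also have "\<dots> = E n0 * real (Suc n + 2) ^ L"
      by (simp add: power_divide add.commute)
    finally show ?case .
  qed
  \<comment> \<open>The sum over \<open>i \<le> n0\<close> in the constant takes care of the indices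
    before \<open>E\<close> becomes useful.\<close>
  have "(q n)\<^sup>2 \<le> (2 * E n0 + (\<Sum>i\<le>n0. (q i)\<^sup>2)) * real (n + 2) ^ L" for n
  proof -
    have one: "(1::real) \<le> real (n + 2) ^ L" by (intro one_le_power) simp
    have S: "0 \<le> (\<Sum>i\<le>n0. (q i)\<^sup>2)" by (intro sum_nonneg) auto
    show ?thesis
    proof (cases "n \<ge> n0")
      case True
      have "(q n)\<^sup>2 \<le> 2 * E n" using E_ge[OF True] zero_le_power2[of "q (Suc n)"] by linarith
      also have "\<dots> \<le> 2 * (E n0 * real (n + 2) ^ L)" using E_bound[OF True] by simp
      also have "\<dots> \<le> (2 * E n0 + (\<Sum>i\<le>n0. (q i)\<^sup>2)) * real (n + 2) ^ L"
        using S one by (simp add: algebra_simps)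
      finally show ?thesis .
    next
      case False
      have "(q n)\<^sup>2 \<le> (\<Sum>i\<le>n0. (q i)\<^sup>2)" using False by (intro member_le_sum) auto
      also have "\<dots> \<le> (2 * E n0 + (\<Sum>i\<le>n0. (q i)\<^sup>2)) * 1" using E_nonneg[of n0] by simp
      also have "\<dots> \<le> (2 * E n0 + (\<Sum>i\<le>n0. (q i)\<^sup>2)) * real (n + 2) ^ L"
        using E_nonneg[of n0] S one by (intro mult_left_mono) auto
      finally show ?thesis .
    qed
  qed
  thus ?thesis by blast
qed

text \<open>Damping the formal eigenvector by a slowly varying \<phi> leaves as residual only the
  commutator of the Jacobi matrix with multiplication by \<phi>, whose entries are
  \<open>c n * (\<phi> (Suc n) - \<phi> n)\<close>. As \<open>C\<close> is arbitrary, no bounded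
  inverse can exist.\<close>

lemma approximate_eigenvector:
  fixes x :: real
  shows "\<exists>w\<in>ell2. (\<lambda>n. jacobi_op c w n - complex_of_real x * w n) \<in> ell2 \<and>
     C * ell2_norm (\<lambda>n. jacobi_op c w n - complex_of_real x * w n) < ell2_norm w"
proof -
  \<comment> \<open>Since \<open>c\<close> and \<open>x\<close> are real, the real part satisfies
    the same recurrence.\<close>
  define q where "q n = Re (jacobi_sol c (\<lambda>_. 0) (complex_of_real x) 1 n)" for n
  have q_rec: "c (Suc n) * q (Suc (Suc n)) + c n * q n = x * q (Suc n)" for n
    using arg_cong[OF jacobi_op_sol[of "\<lambda>_. 0" "complex_of_real x" 1 "Suc n"], of Re]
    by (simp add: q_def jacobi_op_Suc del: jacobi_sol.simps)
  have q_rec0: "c 0 * q 1 = x * q 0"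
    using arg_cong[OF jacobi_op_sol[of "\<lambda>_. 0" "complex_of_real x" 1 0], of Re]
    by (simp add: q_def jacobi_op_0 del: jacobi_sol.simps)
  have q0: "q 0 = 1" by (simp add: q_def)
  obtain A L where A: "\<And>n. (q n)\<^sup>2 \<le> A * real (n + 2) ^ L"
    using polynomial_growth[OF q_rec] by blast
  \<comment> \<open>With \<open>2 * s = 2 * L + 2\<close>, the damping beats the growth of
    \<open>q\<^sup>2\<close> by at least two powers, which gives summability.\<close>
  define s where "s = Suc L"
  \<comment> \<open>The factor \<open>K * (real s)\<^sup>2\<close> comes from the increments of
    \<phi>, and \<open>(2 ^ s)\<^sup>2\<close> from replacing \<open>\<phi> n\<close> by
    \<open>\<phi> (Suc n)\<close> in \<open>upper_bd\<close>.\<close>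
  define H where "H = K * (real s)\<^sup>2 * (2 ^ s)\<^sup>2"
  have H_nonneg: "0 \<le> H" using K_pos by (simp add: H_def)
  \<comment> \<open>The squared residual will be at most \<open>4 * H / m\<close> times the squared
    norm of \<open>w\<close>, so this \<open>m\<close> beats \<open>C\<close>. The bound
    \<open>m \<ge> 2\<close> gives \<open>n + m \<ge> n + 2\<close> in the summability
    estimate.\<close>
  obtain m where m: "max 2 (4 * H * C\<^sup>2 + 1) \<le> real m" using real_arch_simple by blast
  have m2: "m \<ge> 2" using m by simp
  define \<phi> where "\<phi> n = 1 / real (n + m) ^ s" for n
  define r where "r n = q n * \<phi> n" for n
  define w where "w n = complex_of_real (r n)" for n
  define g where "g n = jacobi_op c w n - complex_of_real x * w n" for n
  have A0: "A \<ge> 0"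
    using A[of 0] q0 by (smt (verit) mult_nonneg_nonneg mult_nonpos_nonneg of_nat_0_le_iff one_power2 zero_le_power)
  have r_summable: "summable (\<lambda>n. (r n)\<^sup>2)"
  proof (rule summable_comparison_test'[where g = "\<lambda>n. A * inverse (real (n + 2) ^ 2)" and N = 0])
    show "summable (\<lambda>n. A * inverse (real (n + 2) ^ 2))"
      using summable_iff_shift[of "\<lambda>n. inverse (real n ^ 2)" 2] inverse_power_summable[of 2, where 'a = real]
      by (intro summable_mult) simp
    show "norm ((r n)\<^sup>2) \<le> A * inverse (real (n + 2) ^ 2)" for n
    proof -
      have "(real (n + 2) ^ s)\<^sup>2 \<le> (real (n + m) ^ s)\<^sup>2"
        using m2 by (intro power_mono) auto
      moreover have "(real (n + 2) ^ s)\<^sup>2 = real (n + 2) ^ L * real (n + 2) ^ L * (real (n + 2))\<^sup>2"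
        by (simp add: s_def power2_eq_square algebra_simps)
      moreover have "real (n + 2) ^ L * 1 * (real (n + 2))\<^sup>2 \<le> real (n + 2) ^ L * real (n + 2) ^ L * (real (n + 2))\<^sup>2"
        by (intro mult_right_mono mult_left_mono one_le_power) auto
      ultimately have ge: "real (n + 2) ^ L * (real (n + 2))\<^sup>2 \<le> (real (n + m) ^ s)\<^sup>2"
        unfolding mult_1_right by linarith
      have "(r n)\<^sup>2 = (q n)\<^sup>2 / (real (n + m) ^ s)\<^sup>2"
        by (simp add: r_def \<phi>_def power_mult_distrib power_divide)
      also have "\<dots> \<le> (A * real (n + 2) ^ L) / (real (n + 2) ^ L * (real (n + 2))\<^sup>2)"
        by (intro frac_le A ge) (use A0 in auto)
      also have "\<dots> = A * inverse (real (n + 2) ^ 2)" by (simp add: divide_inverse)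
      finally show ?thesis by simp
    qed
  qed
  have w: "w \<in> ell2" using r_summable by (simp add: ell2_def w_def)
  \<comment> \<open>The growth of \<open>(c n)\<^sup>2\<close> costs a factor \<open>n + 1\<close>,
    the squared relative increment of \<phi> gains \<open>(n + m + 1)\<^sup>2\<close>, and the
    quotient is at most \<open>1 / m\<close> uniformly in \<open>n\<close>.\<close>
  have c\<phi>: "(c n * (\<phi> (Suc n) - \<phi> n))\<^sup>2 \<le> K * (real s)\<^sup>2 / real m * (\<phi> n)\<^sup>2" for n
  proof -
    have "\<bar>\<phi> (Suc n) - \<phi> n\<bar> \<le> real s / (real (n + m) + 1) * \<phi> n"
      using inverse_power_diff(1)[of "real (n + m)" s] m2 by (simp add: \<phi>_def add_ac)
    hence "\<bar>\<phi> (Suc n) - \<phi> n\<bar>\<^sup>2 \<le> (real s / (real (n + m) + 1) * \<phi> n)\<^sup>2"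
      by (intro power_mono) auto
    hence "(c n)\<^sup>2 * (\<phi> (Suc n) - \<phi> n)\<^sup>2 \<le> (K * real (Suc n)) * (real s / (real (n + m) + 1) * \<phi> n)\<^sup>2"
      using K_pos by (intro mult_mono c_sq_le) auto
    also have "\<dots> = K * (real s)\<^sup>2 * (\<phi> n)\<^sup>2 * (real (Suc n) / (real (n + m) + 1)\<^sup>2)"
      by (simp add: power_mult_distrib power_divide)
    also have "\<dots> \<le> K * (real s)\<^sup>2 * (\<phi> n)\<^sup>2 * (1 / real m)"
    proof (intro mult_left_mono)
      have "real (Suc n) * real m \<le> (real (n + m) + 1) * (real (n + m) + 1)"
        by (intro mult_mono) auto
      thus "real (Suc n) / (real (n + m) + 1)\<^sup>2 \<le> 1 / real m"
        using m2 by (simp add: divide_simps power2_eq_square)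
    qed (use K_pos in auto)
    finally show ?thesis by (simp add: power_mult_distrib)
  qed
  have \<phi>_nonneg: "0 \<le> \<phi> n" for n by (simp add: \<phi>_def)
  have lower_bd: "(c n * (\<phi> (Suc n) - \<phi> n) * q n)\<^sup>2 \<le> H / real m * (r n)\<^sup>2" for n
  proof -
    have "(c n * (\<phi> (Suc n) - \<phi> n))\<^sup>2 * (q n)\<^sup>2 \<le> K * (real s)\<^sup>2 / real m * (\<phi> n)\<^sup>2 * (q n)\<^sup>2"
      by (intro mult_right_mono c\<phi>) auto
    also have "\<dots> = (K * (real s)\<^sup>2 * 1) / real m * (r n)\<^sup>2"
      by (simp add: r_def power_mult_distrib)
    also have "\<dots> \<le> H / real m * (r n)\<^sup>2"
      unfolding H_def using K_pos
      by (intro mult_right_mono divide_right_mono mult_left_mono one_le_power) auto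
    finally show ?thesis by (simp add: power_mult_distrib)
  qed
  have upper_bd: "(c n * (\<phi> (Suc n) - \<phi> n) * q (Suc n))\<^sup>2 \<le> H / real m * (r (Suc n))\<^sup>2" for n
  proof -
    have "\<phi> n \<le> 2 ^ s * \<phi> (Suc n)"
      using inverse_power_diff(2)[of "real (n + m)" s] m2 by (simp add: \<phi>_def add_ac)
    hence \<phi>2: "(\<phi> n)\<^sup>2 \<le> (2 ^ s * \<phi> (Suc n))\<^sup>2" by (intro power_mono \<phi>_nonneg)
    have "(c n * (\<phi> (Suc n) - \<phi> n))\<^sup>2 * (q (Suc n))\<^sup>2 \<le> K * (real s)\<^sup>2 / real m * (\<phi> n)\<^sup>2 * (q (Suc n))\<^sup>2"
      by (intro mult_right_mono c\<phi>) auto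
    also have "\<dots> \<le> K * (real s)\<^sup>2 / real m * (2 ^ s * \<phi> (Suc n))\<^sup>2 * (q (Suc n))\<^sup>2"
      using K_pos by (intro mult_right_mono mult_left_mono \<phi>2) auto
    also have "\<dots> = H / real m * (r (Suc n))\<^sup>2"
      by (simp add: r_def H_def power_mult_distrib)
    finally show ?thesis by (simp add: power_mult_distrib)
  qed
  define R where "R n = 2 * (H / real m) * ((r (Suc n))\<^sup>2 + (if n = 0 then 0 else (r (n - 1))\<^sup>2))" for n
  have g_le: "(cmod (g n))\<^sup>2 \<le> R n" for n
  proof (cases n)
    case 0
    have "g 0 = complex_of_real (c 0 * r 1 - x * r 0)"
      by (simp add: g_def jacobi_op_0 w_def)
    also have "c 0 * r 1 - x * r 0 = c 0 * (\<phi> 1 - \<phi> 0) * q 1"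
    proof -
      have xr: "x * r 0 = c 0 * q 1 * \<phi> 0"
        by (simp only: r_def mult.assoc[symmetric] q_rec0)
      show ?thesis unfolding xr by (simp add: r_def algebra_simps)
    qed
    finally have "(cmod (g 0))\<^sup>2 = (c 0 * (\<phi> 1 - \<phi> 0) * q 1)\<^sup>2" by (simp only: norm_of_real power2_abs)
    also have "\<dots> \<le> H / real m * (r 1)\<^sup>2" using upper_bd[of 0] by simp
    also have "\<dots> \<le> 2 * (H / real m) * (r 1)\<^sup>2"
    proof (rule mult_right_mono)
      have "0 \<le> H / real m" using H_nonneg by simp
      thus "H / real m \<le> 2 * (H / real m)" by linarith
    qed simp
    finally show ?thesis using 0 by (simp add: R_def)
  next
    case (Suc k)
    let ?a = "c (Suc k) * (\<phi> (Suc (Suc k)) - \<phi> (Suc k)) * q (Suc (Suc k))"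
    let ?b = "- (c k * (\<phi> (Suc k) - \<phi> k) * q k)"
    \<comment> \<open>The recurrence for \<open>q\<close>, multiplied by
      \<open>\<phi> (Suc k)\<close>, cancels everything except the increments of \<phi>.\<close>
    have "x * r (Suc k) = (c (Suc k) * q (Suc (Suc k)) + c k * q k) * \<phi> (Suc k)"
      by (simp add: r_def q_rec)
    hence "c (Suc k) * r (Suc (Suc k)) + c k * r k - x * r (Suc k) = ?a + ?b"
      by (simp add: r_def algebra_simps)
    hence "g n = complex_of_real (?a + ?b)"
      unfolding g_def Suc jacobi_op_Suc w_def
      by (metis of_real_add of_real_diff of_real_mult)
    hence "(cmod (g n))\<^sup>2 = (?a + ?b)\<^sup>2" by (simp only: norm_of_real power2_abs)
    also have "\<dots> \<le> 2 * ?a\<^sup>2 + 2 * ?b\<^sup>2"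
      using sum_squares_bound[of ?a ?b] unfolding power2_sum by linarith
    also have "\<dots> \<le> 2 * (H / real m * (r (Suc (Suc k)))\<^sup>2) + 2 * (H / real m * (r k)\<^sup>2)"
      using upper_bd[of "Suc k"] lower_bd[of k] by (intro add_mono mult_left_mono) (auto simp: power2_eq_square)
    also have "\<dots> = R n" by (simp add: R_def Suc algebra_simps)
    finally show ?thesis .
  qed
  let ?W = "\<Sum>n. (r n)\<^sup>2"
  have shift: "(\<lambda>n. if n = 0 then 0 else (r (n - 1))\<^sup>2) sums ?W"
    using sums_Suc[of "\<lambda>n. if n = 0 then 0 else (r (n - 1))\<^sup>2" ?W] summable_sums[OF r_summable] by simp
  have shift': "(\<lambda>n. (r (Suc n))\<^sup>2) sums (?W - (r 0)\<^sup>2)"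
    using summable_sums[OF r_summable] by (subst sums_Suc_iff) simp
  have R_sums: "R sums (2 * (H / real m) * ((?W - (r 0)\<^sup>2) + ?W))"
    unfolding R_def by (intro sums_mult sums_add shift shift')
  have g_summable: "summable (\<lambda>n. (cmod (g n))\<^sup>2)"
    by (rule summable_comparison_test'[OF sums_summable[OF R_sums], of 0]) (use g_le in simp)
  hence g: "g \<in> ell2" by (simp add: ell2_def)
  have w_norm: "(ell2_norm w)\<^sup>2 = ?W" using ell2_norm_sq[OF w] by (simp add: w_def)
  have "(ell2_norm g)\<^sup>2 \<le> suminf R"
    unfolding ell2_norm_sq[OF g] by (rule suminf_le[OF g_le g_summable sums_summable[OF R_sums]])
  also have "\<dots> = 2 * (H / real m) * ((?W - (r 0)\<^sup>2) + ?W)" by (rule sums_unique[OF R_sums, symmetric])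
  also have "\<dots> \<le> 2 * (H / real m) * (?W + ?W)"
    using H_nonneg by (intro mult_left_mono) auto
  finally have g_norm: "(ell2_norm g)\<^sup>2 \<le> 4 * H / real m * (ell2_norm w)\<^sup>2"
    unfolding w_norm by (simp add: field_simps)
  have "w 0 \<noteq> 0" using m2 by (simp add: w_def r_def q0 \<phi>_def)
  hence w_pos: "ell2_norm w > 0"
    using ell2_norm_eq_0_D[OF w, of 0] ell2_norm_nonneg[OF w] by linarith
  have "(C * ell2_norm g)\<^sup>2 \<le> C\<^sup>2 * (4 * H / real m * (ell2_norm w)\<^sup>2)"
    unfolding power_mult_distrib by (intro mult_left_mono g_norm) auto
  also have "\<dots> = (4 * H * C\<^sup>2 / real m) * (ell2_norm w)\<^sup>2" by simp
  also have "\<dots> < 1 * (ell2_norm w)\<^sup>2"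
    using m m2 w_pos by (intro mult_strict_right_mono) (auto simp: field_simps)
  finally have "C * ell2_norm g < ell2_norm w"
    using w_pos by (intro power2_less_imp_less[of "C * ell2_norm g"]) auto
  thus ?thesis using w g unfolding g_def by blast
qed

end

subsection \<open>Contiguous relations\<close>

text \<open>Coefficient comparison: the constant terms cancel, and at index \<open>k + 1\<close> the
  difference of the numerators is \<open>k + 1\<close> times the Pochhammer symbol of length
  \<open>k\<close>. This relation yields the odd rows of the eigenvector equation.\<close>

lemma hyp1F1_contiguous_step:
  assumes "c > 0"
  shows "hyp1F1 n c z - hyp1F1 (Suc n) c z = z / c * hyp1F1 n (c + 1) z"
proof -
  define f where "f m k = pochhammer (- real m) k / (pochhammer c k * fact k) * z ^ k" for m k
  \<comment> \<open>The vanishing next coefficient lets both series be summed up to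
    \<open>Suc n\<close>.\<close>
  have top: "pochhammer (- real n) (Suc n) = 0"
    by (simp add: pochhammer_of_nat_eq_0_lemma)
  have "hyp1F1 n c z - hyp1F1 (Suc n) c z = (\<Sum>k\<le>Suc n. f n k - f (Suc n) k)"
    by (simp add: hyp1F1_def f_def sum_subtractf top)
  also have "\<dots> = (\<Sum>k\<le>n. f n (Suc k) - f (Suc n) (Suc k))"
    by (subst sum.atMost_Suc_shift) (simp add: f_def)
  also have "\<dots> = (\<Sum>k\<le>n. z / c * (pochhammer (- real n) k / (pochhammer (c + 1) k * fact k) * z ^ k))"
  proof (rule sum.cong)
    fix k
    have 1: "pochhammer (- real n) (Suc k) - pochhammer (- real (Suc n)) (Suc k)
        = real (Suc k) * pochhammer (- real n) k"
      by (subst pochhammer_rec[of "- real (Suc n)"], subst pochhammer_rec') (simp add: algebra_simps)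
    have "f n (Suc k) - f (Suc n) (Suc k)
        = (pochhammer (- real n) (Suc k) - pochhammer (- real (Suc n)) (Suc k))
            / (pochhammer c (Suc k) * fact (Suc k)) * z ^ Suc k"
      by (simp add: f_def diff_divide_distrib left_diff_distrib del: pochhammer_Suc fact_Suc power_Suc)
    also have "\<dots> = (real (Suc k) * pochhammer (- real n) k)
            / ((c * pochhammer (c + 1) k) * (real (Suc k) * fact k)) * (z * z ^ k)"
      unfolding 1 pochhammer_rec[of c] by simp
    also have "\<dots> = z / c * (pochhammer (- real n) k / (pochhammer (c + 1) k * fact k) * z ^ k)"
      using assms by (simp add: field_simps pochhammer_pos less_imp_neq[symmetric] del: of_nat_Suc)
    finally show "f n (Suc k) - f (Suc n) (Suc k)
      = z / c * (pochhammer (- real n) k / (pochhammer (c + 1) k * fact k) * z ^ k)" .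
  qed simp
  finally show ?thesis by (simp add: hyp1F1_def sum_distrib_left)
qed

text \<open>This relation yields the even rows of the eigenvector equation. At \<open>n = 0\<close>
  the truncated index \<open>n - 1\<close> is harmless, since its term has the factor
  \<open>real n\<close>.\<close>

lemma hyp1F1_contiguous_param:
  assumes "c > 0"
  shows "(c + real n) * hyp1F1 n (c + 1) z - real n * hyp1F1 (n - 1) (c + 1) z = c * hyp1F1 n c z"
proof (cases n)
  case 0
  then show ?thesis by (simp add: hyp1F1_def)
next
  case (Suc m)
  define d where "d k = pochhammer (c + 1) k * fact k" for k
  have d_pos: "d k > 0" for k using assms by (simp add: d_def pochhammer_pos)
  have top: "pochhammer (- real m) n = 0"
    using Suc by (simp add: pochhammer_of_nat_eq_0_lemma)
  have "hyp1F1 (n - 1) (c + 1) z = (\<Sum>k\<le>n. pochhammer (- real m) k / d k * z ^ k)"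
    using top by (simp add: hyp1F1_def Suc d_def)
  moreover have "hyp1F1 n (c + 1) z = (\<Sum>k\<le>n. pochhammer (- real n) k / d k * z ^ k)"
    by (simp add: hyp1F1_def d_def)
  ultimately have "(c + real n) * hyp1F1 n (c + 1) z - real n * hyp1F1 (n - 1) (c + 1) z
      = (\<Sum>k\<le>n. ((c + real n) * pochhammer (- real n) k - real n * pochhammer (- real m) k) / d k * z ^ k)"
    by (simp only: sum_distrib_left sum_subtractf[symmetric])
       (simp add: diff_divide_distrib left_diff_distrib mult.assoc)
  also have "\<dots> = (\<Sum>k\<le>n. c * (pochhammer (- real n) k / (pochhammer c k * fact k) * z ^ k))"
  proof (rule sum.cong)
    fix k
    have 1: "real n * pochhammer (- real m) k = (real n - real k) * pochhammer (- real n) k"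
    proof -
      have "pochhammer (- real n) (Suc k) = - real n * pochhammer (- real m) k"
        by (subst pochhammer_rec) (simp add: Suc)
      moreover have "pochhammer (- real n) (Suc k) = (real k - real n) * pochhammer (- real n) k"
        by (subst pochhammer_rec') simp
      ultimately show ?thesis by (simp add: algebra_simps)
    qed
    have 2: "c * pochhammer (c + 1) k = (c + real k) * pochhammer c k"
      using pochhammer_rec[of c k] pochhammer_rec'[of c k] by simp
    have "((c + real n) * pochhammer (- real n) k - real n * pochhammer (- real m) k) / d k
      = (c + real k) * pochhammer (- real n) k / d k"
      unfolding 1 by (simp add: algebra_simps)
    also have "\<dots> = c * (pochhammer (- real n) k / (pochhammer c k * fact k))"
    proof -
      have "pochhammer (c + 1) k = (c + real k) * pochhammer c k / c"
        using 2 assms by (simp add: field_simps)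
      thus ?thesis using assms by (simp add: d_def)
    qed
    finally show "((c + real n) * pochhammer (- real n) k - real n * pochhammer (- real m) k) / d k * z ^ k
      = c * (pochhammer (- real n) k / (pochhammer c k * fact k) * z ^ k)" by simp
  qed simp
  finally show ?thesis by (simp add: hyp1F1_def sum_distrib_left)
qed

subsection \<open>Orthogonality of the generalized Hermite polynomials\<close>

lemma alternating_binomial_sum_Suc:
  fixes f :: "nat \<Rightarrow> real"
  shows "(\<Sum>k\<le>Suc n. (- 1) ^ k * real (Suc n choose k) * f k)
    = (\<Sum>k\<le>n. (- 1) ^ k * real (n choose k) * (f k - f (Suc k)))"
proof -
  have "(\<Sum>k\<le>Suc n. (- 1) ^ k * real (Suc n choose k) * f k)
      = f 0 + (\<Sum>k\<le>n. (- 1) ^ Suc k * real (Suc n choose Suc k) * f (Suc k))"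
    by (subst sum.atMost_Suc_shift) simp
  \<comment> \<open>Pascal's rule splits the binomial coefficient; the two resulting sums regroup
    into differences of \<open>f\<close>.\<close>
  also have "(\<Sum>k\<le>n. (- 1) ^ Suc k * real (Suc n choose Suc k) * f (Suc k))
      = (\<Sum>k\<le>n. (- 1) ^ Suc k * real (n choose Suc k) * f (Suc k) - (- 1) ^ k * real (n choose k) * f (Suc k))"
    by (intro sum.cong refl) (simp add: algebra_simps)
  also have "f 0 + \<dots> = f 0 + (\<Sum>k\<le>n. (- 1) ^ Suc k * real (n choose Suc k) * f (Suc k))
          - (\<Sum>k\<le>n. (- 1) ^ k * real (n choose k) * f (Suc k))"
    by (simp add: sum_subtractf)
  also have "f 0 + (\<Sum>k\<le>n. (- 1) ^ Suc k * real (n choose Suc k) * f (Suc k))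
      = (\<Sum>k\<le>Suc n. (- 1) ^ k * real (n choose k) * f k)"
    by (subst sum.atMost_Suc_shift) simp
  also have "\<dots> = (\<Sum>k\<le>n. (- 1) ^ k * real (n choose k) * f k)" by simp
  finally show ?thesis by (simp add: sum_subtractf[symmetric] right_diff_distrib)
qed

text \<open>As a polynomial in \<open>k\<close>, the Pochhammer symbol has degree \<open>j\<close>,
  and one difference lowers \<open>j\<close> by one at the price of a factor and a shift of
  \<open>b\<close>. The induction therefore varies both \<open>j\<close> and
  \<open>b\<close>.\<close>

lemma alternating_binomial_sum_pochhammer:
  fixes b :: real
  assumes "j \<le> n"
  shows "(\<Sum>k\<le>n. (- 1) ^ k * real (n choose k) * pochhammer (b + real k) j)
    = (if j = n then (- 1) ^ n * fact n else 0)"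
  using assms
proof (induction n arbitrary: j b)
  case 0
  thus ?case by simp
next
  case (Suc n)
  show ?case
  proof (cases j)
    case 0
    thus ?thesis by (subst alternating_binomial_sum_Suc) simp
  next
    case (Suc i)
    have step: "pochhammer (b + real k) (Suc i) - pochhammer (b + real (Suc k)) (Suc i)
        = - real (Suc i) * pochhammer (b + 1 + real k) i" for k
    proof -
      have "pochhammer (b + real k) (Suc i) = (b + real k) * pochhammer (b + 1 + real k) i"
        by (simp only: pochhammer_rec) (simp add: add_ac)
      moreover have "pochhammer (b + real (Suc k)) (Suc i) = (b + 1 + real k + real i) * pochhammer (b + 1 + real k) i"
        by (simp only: pochhammer_rec') (simp add: add_ac)
      ultimately show ?thesis by (simp only:) (simp add: algebra_simps)
    qed
    have "(\<Sum>k\<le>Suc n. (- 1) ^ k * real (Suc n choose k) * pochhammer (b + real k) j)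
        = - real (Suc i) * (\<Sum>k\<le>n. (- 1) ^ k * real (n choose k) * pochhammer (b + 1 + real k) i)"
      unfolding alternating_binomial_sum_Suc Suc step sum_distrib_left by (simp only: mult_ac)
    also have "\<dots> = - real (Suc i) * (if i = n then (- 1) ^ n * fact n else 0)"
      using Suc.IH[of i "b + 1"] Suc.prems Suc by simp
    also have "\<dots> = (if j = Suc n then (- 1) ^ Suc n * fact (Suc n) else 0)"
      using Suc by (auto simp: algebra_simps)
    finally show ?thesis .
  qed
qed

definition laguerre_coeff :: "nat \<Rightarrow> real \<Rightarrow> nat \<Rightarrow> real" where
  "laguerre_coeff n \<alpha> k = (- 1) ^ k * ((real n + \<alpha>) gchoose (n - k)) / fact k"

lemma laguerre_eq_sum: "laguerre n \<alpha> u = (\<Sum>k\<le>n. laguerre_coeff n \<alpha> k * u ^ k)"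
  by (simp add: laguerre_def laguerre_coeff_def)

text \<open>The Laguerre parameter is \<open>s - 1\<close>, so the coefficient has
  \<open>Gamma (s + real k)\<close> in its denominator. Against the moment this leaves a Pochhammer
  symbol of length \<open>j\<close>, and orthogonality becomes the vanishing of a finite
  difference.\<close>

lemma laguerre_coeff_moment:
  assumes s: "s > 0" and k: "k \<le> n"
  shows "laguerre_coeff n (s - 1) k * Gamma (s + real (k + j))
    = Gamma (s + real n) / fact n * ((- 1) ^ k * real (n choose k) * pochhammer (s + real k) j)"
proof -
  have "s + real k \<notin> \<int>\<^sub>\<le>\<^sub>0" using s by (auto elim!: nonpos_Ints_cases)
  note poch = pochhammer_Gamma[OF this]
  have pos: "Gamma (s + real k) > 0" using s by (intro Gamma_real_pos) simp
  have "(real n + (s - 1)) gchoose (n - k) = pochhammer (s + real k) (n - k) / fact (n - k)"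
    unfolding gbinomial_pochhammer' using k by (simp add: of_nat_diff add_ac)
  also have "pochhammer (s + real k) (n - k) = Gamma (s + real n) / Gamma (s + real k)"
    unfolding poch using k by (simp add: of_nat_diff)
  finally have 1: "laguerre_coeff n (s - 1) k = (- 1) ^ k * (Gamma (s + real n) / Gamma (s + real k) / fact (n - k)) / fact k"
    by (simp add: laguerre_coeff_def)
  have 2: "Gamma (s + real (k + j)) = pochhammer (s + real k) j * Gamma (s + real k)"
    unfolding poch using pos by (simp add: add_ac)
  have 3: "real (n choose k) = fact n / (fact k * fact (n - k))"
    using k by (rule binomial_fact)
  show ?thesis unfolding 1 2 3 using pos by (simp add: mult_ac)
qed

lemma laguerre_moment_sum:
  assumes "s > 0" "j \<le> n"
  shows "(\<Sum>k\<le>n. laguerre_coeff n (s - 1) k * Gamma (s + real (k + j)))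
    = (if j = n then (- 1) ^ n * Gamma (s + real n) else 0)"
proof -
  have "(\<Sum>k\<le>n. laguerre_coeff n (s - 1) k * Gamma (s + real (k + j)))
      = Gamma (s + real n) / fact n * (\<Sum>k\<le>n. (- 1) ^ k * real (n choose k) * pochhammer (s + real k) j)"
    unfolding sum_distrib_left by (intro sum.cong refl laguerre_coeff_moment assms) simp
  thus ?thesis using assms(2) by (simp add: alternating_binomial_sum_pochhammer)
qed

section \<open>Moments of the weight\<close>

definition gamma_weight :: "real \<Rightarrow> real \<Rightarrow> real" where
  "gamma_weight s x = \<bar>x\<bar> powr (2 * s - 1) * exp (- x\<^sup>2)"

lemma gamma_weight_measurable [measurable]: "gamma_weight s \<in> borel_measurable borel"
  unfolding gamma_weight_def by measurable

lemma gamma_weight_minus: "gamma_weight s (- x) = gamma_weight s x"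
  by (simp add: gamma_weight_def)

lemma power_mult_gamma_weight: "(x\<^sup>2) ^ j * gamma_weight s x = gamma_weight (s + real j) x"
proof (cases "x = 0")
  case False
  have "(x\<^sup>2) ^ j = \<bar>x\<bar> powr (2 * real j)"
    using False by (simp add: powr_realpow[symmetric] powr_powr[symmetric])
  thus ?thesis using False by (simp add: gamma_weight_def powr_add[symmetric] algebra_simps)
qed (simp add: gamma_weight_def)

lemma abs_mult_gamma_weight: "\<bar>x\<bar> * gamma_weight s x = gamma_weight (s + 1 / 2) x"
proof (cases "x = 0")
  case False
  have "\<bar>x\<bar> * \<bar>x\<bar> powr (2 * s - 1) = \<bar>x\<bar> powr (2 * s)"
    using False by (simp add: powr_diff)
  thus ?thesis by (simp add: gamma_weight_def)
qed (simp add: gamma_weight_def)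

lemma gamma_weight_half_integral:
  assumes s: "s > 0"
  shows "has_bochner_integral lborel (\<lambda>x. indicator {0..} x *\<^sub>R gamma_weight s x) (Gamma s / 2)"
proof -
  let ?f = "\<lambda>t::real. t powr (s - 1) / exp t"
  have image: "(\<lambda>x::real. x\<^sup>2) ` {0..} = {0..}"
  proof safe
    fix y :: real assume "0 \<le> y"
    thus "y \<in> (\<lambda>x. x\<^sup>2) ` {0..}" by (intro image_eqI[of _ _ "sqrt y"]) auto
  qed auto
  have abs_int: "?f absolutely_integrable_on {0..}" and int: "integral {0..} ?f = Gamma s"
    using Gamma_integral_real[OF s]
    by (auto intro!: nonnegative_absolutely_integrable_1 simp: integral_unique has_integral_integrable)
  have "(\<lambda>x. \<bar>2 * x\<bar> * ?f (x\<^sup>2)) absolutely_integrable_on {0..} \<and>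
      integral {0..} (\<lambda>x. \<bar>2 * x\<bar> * ?f (x\<^sup>2)) = Gamma s"
  proof (subst has_absolute_integral_change_of_variables_1'[where g = "\<lambda>x. x\<^sup>2"])
    show "inj_on (\<lambda>x::real. x\<^sup>2) {0..}" by (auto intro!: inj_onI)
    show "?f absolutely_integrable_on (\<lambda>x. x\<^sup>2) ` {0..} \<and> integral ((\<lambda>x. x\<^sup>2) ` {0..}) ?f = Gamma s"
      unfolding image using abs_int int by simp
  qed (auto intro!: derivative_eq_intros)
  hence "((\<lambda>x. \<bar>2 * x\<bar> * ?f (x\<^sup>2)) has_integral Gamma s) {0..}"
    by (auto simp: has_integral_iff absolutely_integrable_on_def)
  hence "((\<lambda>x. \<bar>2 * x\<bar> * ?f (x\<^sup>2) * (1 / 2)) has_integral Gamma s * (1 / 2)) {0..}"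
    by (rule has_integral_mult_left)
  also have "(\<lambda>x. \<bar>2 * x\<bar> * ?f (x\<^sup>2) * (1 / 2)) = gamma_weight s"
  proof
    fix x :: real
    show "\<bar>2 * x\<bar> * ?f (x\<^sup>2) * (1 / 2) = gamma_weight s x"
    proof (cases "x = 0")
      case False
      have "x\<^sup>2 = \<bar>x\<bar> powr 2" using False by simp
      hence "(x\<^sup>2) powr (s - 1) = \<bar>x\<bar> powr (2 * (s - 1))" by (simp only: powr_powr)
      hence "\<bar>x\<bar> * (x\<^sup>2) powr (s - 1) = \<bar>x\<bar> powr 1 * \<bar>x\<bar> powr (2 * (s - 1))" using False by simp
      also have "\<dots> = \<bar>x\<bar> powr (2 * s - 1)" by (simp only: powr_add[symmetric]) simp
      finally have powr_eq: "\<bar>x\<bar> * (x\<^sup>2) powr (s - 1) = \<bar>x\<bar> powr (2 * s - 1)" .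
      have "\<bar>2 * x\<bar> * ?f (x\<^sup>2) * (1 / 2) = \<bar>x\<bar> * (x\<^sup>2) powr (s - 1) / exp (x\<^sup>2)"
        by (simp add: abs_mult)
      thus ?thesis by (simp only: powr_eq gamma_weight_def exp_minus divide_inverse)
    qed (simp add: gamma_weight_def)
  qed
  finally have "(gamma_weight s has_integral Gamma s / 2) {0..}" by simp
  moreover have nonneg: "0 \<le> gamma_weight s x" for x by (simp add: gamma_weight_def)
  ultimately have "(\<integral>\<^sup>+x. ennreal (indicator {0..} x * gamma_weight s x) \<partial>lborel) = ennreal (Gamma s / 2)"
    by (intro nn_integral_has_integral_lebesgue) auto
  thus ?thesis
    using Gamma_real_pos[OF s]
    by (intro has_bochner_integral_nn_integral) (auto simp: nonneg)
qed

lemma gamma_weight_moment: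
  assumes s: "s > 0"
  shows "has_bochner_integral lborel (\<lambda>x. (x\<^sup>2) ^ j * gamma_weight s x) (Gamma (s + real j))"
  using has_bochner_integral_even_function[OF gamma_weight_half_integral[of "s + real j"] gamma_weight_minus] s
  by (simp add: power_mult_gamma_weight)

lemma gamma_weight_odd_moment:
  assumes s: "s > 0"
  shows "has_bochner_integral lborel (\<lambda>x. x * (x\<^sup>2) ^ j * gamma_weight s x) 0"
proof (rule has_bochner_integral_odd_function)
  have "has_bochner_integral lborel (\<lambda>x. indicator {0..} x *\<^sub>R gamma_weight (s + real j + 1 / 2) x)
      (Gamma (s + real j + 1 / 2) / 2)"
    using s by (intro gamma_weight_half_integral) simp
  moreover have "indicator {0..} x *\<^sub>R gamma_weight (s + real j + 1 / 2) x
      = indicator {0..} x *\<^sub>R (x * (x\<^sup>2) ^ j * gamma_weight s x)" for x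
    unfolding abs_mult_gamma_weight[symmetric] power_mult_gamma_weight[symmetric]
    by (auto simp: indicator_def)
  ultimately show "has_bochner_integral lborel
      (\<lambda>x. indicator {0..} x *\<^sub>R (x * (x\<^sup>2) ^ j * gamma_weight s x)) (Gamma (s + real j + 1 / 2) / 2)"
    by (simp only:)
qed (simp add: gamma_weight_minus)

lemma laguerre_orthogonal_power:
  assumes s: "s > 0" and j: "j \<le> n"
  shows "has_bochner_integral lborel (\<lambda>x. (x\<^sup>2) ^ j * laguerre n (s - 1) (x\<^sup>2) * gamma_weight s x)
     (if j = n then (- 1) ^ n * Gamma (s + real n) else 0)"
proof -
  have "has_bochner_integral lborel
      (\<lambda>x. \<Sum>k\<le>n. laguerre_coeff n (s - 1) k * ((x\<^sup>2) ^ (k + j) * gamma_weight s x))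
      (\<Sum>k\<le>n. laguerre_coeff n (s - 1) k * Gamma (s + real (k + j)))"
    by (intro has_bochner_integral_sum has_bochner_integral_mult_right gamma_weight_moment s)
  thus ?thesis
    unfolding laguerre_moment_sum[OF s j]
    by (simp add: laguerre_eq_sum sum_distrib_left sum_distrib_right power_add mult_ac)
qed

lemma laguerre_orthogonal_le:
  assumes s: "s > 0" and mn: "m \<le> n"
  shows "has_bochner_integral lborel
     (\<lambda>x. laguerre m (s - 1) (x\<^sup>2) * laguerre n (s - 1) (x\<^sup>2) * gamma_weight s x)
     (if m = n then Gamma (s + real n) / fact n else 0)"
proof -
  have "has_bochner_integral lborel
      (\<lambda>x. \<Sum>j\<le>m. laguerre_coeff m (s - 1) j * ((x\<^sup>2) ^ j * laguerre n (s - 1) (x\<^sup>2) * gamma_weight s x))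
      (\<Sum>j\<le>m. laguerre_coeff m (s - 1) j * (if j = n then (- 1) ^ n * Gamma (s + real n) else 0))"
    using mn by (intro has_bochner_integral_sum has_bochner_integral_mult_right laguerre_orthogonal_power s) auto
  moreover have "(\<Sum>j\<le>m. laguerre_coeff m (s - 1) j * (if j = n then (- 1) ^ n * Gamma (s + real n) else 0))
      = (if m = n then Gamma (s + real n) / fact n else 0)"
  proof (cases "m = n")
    case True
    have "(\<Sum>j\<le>m. laguerre_coeff m (s - 1) j * (if j = n then (- 1) ^ n * Gamma (s + real n) else 0))
        = (\<Sum>j\<le>m. if j = n then laguerre_coeff m (s - 1) j * ((- 1) ^ n * Gamma (s + real n)) else 0)"
      by (intro sum.cong) auto
    also have "\<dots> = laguerre_coeff n (s - 1) n * ((- 1) ^ n * Gamma (s + real n))"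
      using True by simp
    also have "\<dots> = Gamma (s + real n) / fact n"
      by (simp add: laguerre_coeff_def power_mult_distrib[symmetric] mult.assoc[symmetric])
    finally show ?thesis using True by simp
  next
    case False
    thus ?thesis using mn by (auto intro!: sum.neutral)
  qed
  moreover have "(\<Sum>j\<le>m. laguerre_coeff m (s - 1) j * ((x\<^sup>2) ^ j * laguerre n (s - 1) (x\<^sup>2) * gamma_weight s x))
      = laguerre m (s - 1) (x\<^sup>2) * laguerre n (s - 1) (x\<^sup>2) * gamma_weight s x" for x
    unfolding laguerre_eq_sum[of m] sum_distrib_right by (intro sum.cong refl) (simp only: mult_ac)
  ultimately show ?thesis by (simp only:)
qed

lemma laguerre_orthogonal:
  assumes s: "s > 0"
  shows "has_bochner_integral lborel
     (\<lambda>x. laguerre m (s - 1) (x\<^sup>2) * laguerre n (s - 1) (x\<^sup>2) * gamma_weight s x)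
     (if m = n then Gamma (s + real n) / fact n else 0)"
proof (cases "m \<le> n")
  case True
  thus ?thesis by (rule laguerre_orthogonal_le[OF s])
next
  case False
  thus ?thesis using laguerre_orthogonal_le[OF s, of n m] by (simp add: mult_ac)
qed

lemma odd_laguerre_product_integral:
  assumes s: "s > 0"
  shows "has_bochner_integral lborel
     (\<lambda>x. x * laguerre m \<alpha> (x\<^sup>2) * laguerre n \<beta> (x\<^sup>2) * gamma_weight s x) 0"
proof -
  have "has_bochner_integral lborel
      (\<lambda>x. \<Sum>i\<le>m. \<Sum>j\<le>n. laguerre_coeff m \<alpha> i * laguerre_coeff n \<beta> j * (x * (x\<^sup>2) ^ (i + j) * gamma_weight s x))
      (\<Sum>i\<le>m. \<Sum>j\<le>n. laguerre_coeff m \<alpha> i * laguerre_coeff n \<beta> j * 0)"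
    by (intro has_bochner_integral_sum has_bochner_integral_mult_right gamma_weight_odd_moment s)
  moreover have "(\<Sum>i\<le>m. \<Sum>j\<le>n. laguerre_coeff m \<alpha> i * laguerre_coeff n \<beta> j * (x * (x\<^sup>2) ^ (i + j) * gamma_weight s x))
     = x * laguerre m \<alpha> (x\<^sup>2) * laguerre n \<beta> (x\<^sup>2) * gamma_weight s x" for x
  proof -
    have "laguerre m \<alpha> (x\<^sup>2) * laguerre n \<beta> (x\<^sup>2) =
        (\<Sum>i\<le>m. \<Sum>j\<le>n. laguerre_coeff m \<alpha> i * laguerre_coeff n \<beta> j * (x\<^sup>2) ^ (i + j))"
      unfolding laguerre_eq_sum sum_product by (simp add: power_add mult_ac)
    hence "x * (laguerre m \<alpha> (x\<^sup>2) * laguerre n \<beta> (x\<^sup>2)) * gamma_weight s x =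
        (\<Sum>i\<le>m. \<Sum>j\<le>n. laguerre_coeff m \<alpha> i * laguerre_coeff n \<beta> j * (x * (x\<^sup>2) ^ (i + j) * gamma_weight s x))"
      by (simp add: sum_distrib_left sum_distrib_right mult_ac)
    thus ?thesis by (simp add: mult_ac)
  qed
  ultimately show ?thesis by simp
qed

lemma gen_hermite_weight_eq: "x \<noteq> 0 \<Longrightarrow> gen_hermite_weight a x = gamma_weight a x"
  by (simp add: gen_hermite_weight_def gamma_weight_def abs_powr_def)

lemma gen_hermite_weight_measurable [measurable]: "gen_hermite_weight a \<in> borel_measurable borel"
  unfolding gen_hermite_weight_def abs_powr_def by measurable

lemma gen_hermite_measurable [measurable]: "gen_hermite a n \<in> borel_measurable borel"
  unfolding gen_hermite_def laguerre_def by measurable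

lemma gen_hermite_orthogonal:
  assumes a: "a > 0"
  shows "\<exists>N>0. has_bochner_integral lborel
    (\<lambda>x. gen_hermite a m x * gen_hermite a n x * gen_hermite_weight a x) (if m = n then N else 0)"
proof -
  let ?p = "m div 2" and ?q = "n div 2"
  let ?sgn = "(- 1) ^ ?p * (- 1) ^ ?q :: real"
  have sgn: "?sgn = 1" if "?p = ?q" using that by (simp add: power_mult_distrib[symmetric])
  have "\<exists>N>0. has_bochner_integral lborel
    (\<lambda>x. gen_hermite a m x * gen_hermite a n x * gamma_weight a x) (if m = n then N else 0)"
  proof (cases "even m"; cases "even n")
    assume m: "even m" and n: "even n"
    have eq: "m = n \<longleftrightarrow> ?p = ?q" using m n by auto
    have "has_bochner_integral lborel
        (\<lambda>x. ?sgn * (laguerre ?p (a - 1) (x\<^sup>2) * laguerre ?q (a - 1) (x\<^sup>2) * gamma_weight a x))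
        (?sgn * (if ?p = ?q then Gamma (a + real ?q) / fact ?q else 0))"
      by (intro has_bochner_integral_mult_right laguerre_orthogonal a)
    also have "?sgn * (if ?p = ?q then Gamma (a + real ?q) / fact ?q else 0)
        = (if m = n then Gamma (a + real ?q) / fact ?q else 0)"
      using sgn eq by auto
    finally have "has_bochner_integral lborel
        (\<lambda>x. gen_hermite a m x * gen_hermite a n x * gamma_weight a x) (if m = n then Gamma (a + real ?q) / fact ?q else 0)"
      using m n by (simp add: gen_hermite_def mult_ac)
    moreover have "Gamma (a + real ?q) / fact ?q > 0"
      using a by (intro divide_pos_pos Gamma_real_pos) auto
    ultimately show ?thesis by blast
  next
    assume m: "odd m" and n: "odd n"
    have eq: "m = n \<longleftrightarrow> ?p = ?q" using m n by (metis odd_two_times_div_two_succ)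
    have "has_bochner_integral lborel
        (\<lambda>x. ?sgn * (laguerre ?p (a + 1 - 1) (x\<^sup>2) * laguerre ?q (a + 1 - 1) (x\<^sup>2) * gamma_weight (a + 1) x))
        (?sgn * (if ?p = ?q then Gamma (a + 1 + real ?q) / fact ?q else 0))"
      using a by (intro has_bochner_integral_mult_right laguerre_orthogonal) simp
    also have "?sgn * (if ?p = ?q then Gamma (a + 1 + real ?q) / fact ?q else 0)
        = (if m = n then Gamma (a + 1 + real ?q) / fact ?q else 0)"
      using sgn eq by auto
    also have "(\<lambda>x. ?sgn * (laguerre ?p (a + 1 - 1) (x\<^sup>2) * laguerre ?q (a + 1 - 1) (x\<^sup>2) * gamma_weight (a + 1) x))
        = (\<lambda>x. gen_hermite a m x * gen_hermite a n x * gamma_weight a x)"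
    proof
      fix x
      have "gamma_weight (a + 1) x = x * x * gamma_weight a x"
        using power_mult_gamma_weight[of x 1 a] by (simp add: power2_eq_square)
      thus "?sgn * (laguerre ?p (a + 1 - 1) (x\<^sup>2) * laguerre ?q (a + 1 - 1) (x\<^sup>2) * gamma_weight (a + 1) x)
        = gen_hermite a m x * gen_hermite a n x * gamma_weight a x"
        using m n by (simp add: gen_hermite_def mult_ac)
    qed
    finally have "has_bochner_integral lborel
        (\<lambda>x. gen_hermite a m x * gen_hermite a n x * gamma_weight a x) (if m = n then Gamma (a + 1 + real ?q) / fact ?q else 0)" .
    moreover have "Gamma (a + 1 + real ?q) / fact ?q > 0"
      using a by (intro divide_pos_pos Gamma_real_pos) auto
    ultimately show ?thesis by blast
  next
    assume mn: "even m" "odd n"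
    have "has_bochner_integral lborel
        (\<lambda>x. ?sgn * (x * laguerre ?p (a - 1) (x\<^sup>2) * laguerre ?q a (x\<^sup>2) * gamma_weight a x)) (?sgn * 0)"
      by (intro has_bochner_integral_mult_right odd_laguerre_product_integral a)
    thus ?thesis using mn by (intro exI[of _ 1]) (auto simp: gen_hermite_def mult_ac)
  next
    assume mn: "odd m" "even n"
    have "has_bochner_integral lborel
        (\<lambda>x. ?sgn * (x * laguerre ?p a (x\<^sup>2) * laguerre ?q (a - 1) (x\<^sup>2) * gamma_weight a x)) (?sgn * 0)"
      by (intro has_bochner_integral_mult_right odd_laguerre_product_integral a)
    thus ?thesis using mn by (intro exI[of _ 1]) (auto simp: gen_hermite_def mult_ac)
  qed
  moreover have "has_bochner_integral lborel (\<lambda>x. gen_hermite a m x * gen_hermite a n x * gamma_weight a x) I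
    \<longleftrightarrow> has_bochner_integral lborel (\<lambda>x. gen_hermite a m x * gen_hermite a n x * gen_hermite_weight a x) I" for I
    using AE_lborel_singleton[of "0::real"]
    by (intro has_bochner_integral_cong_AE) (auto elim!: eventually_mono simp: gen_hermite_weight_eq)
  ultimately show ?thesis by simp
qed

lemma gen_hermite_weight_function:
  assumes a: "a > 0"
  shows "is_weight_function (gen_hermite_weight a) (gen_hermite a)"
proof -
  have "0 < (LINT x|lborel. (gen_hermite a n x)\<^sup>2 * gen_hermite_weight a x)" for n
  proof -
    obtain N where "N > 0" "has_bochner_integral lborel
      (\<lambda>x. gen_hermite a n x * gen_hermite a n x * gen_hermite_weight a x) N"
      using gen_hermite_orthogonal[OF a, of n n] by auto
    thus ?thesis by (simp add: has_bochner_integral_iff power2_eq_square)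
  qed
  moreover have "(LINT x|lborel. gen_hermite a m x * gen_hermite a n x * gen_hermite_weight a x) = 0"
    if "m \<noteq> n" for m n
    using gen_hermite_orthogonal[OF a, of m n] that by (auto simp: has_bochner_integral_iff)
  moreover have "integrable lborel (\<lambda>x. gen_hermite a m x * gen_hermite a n x * gen_hermite_weight a x)" for m n
    using gen_hermite_orthogonal[OF a, of m n] by (auto simp: has_bochner_integral_iff)
  moreover have "0 \<le> gen_hermite_weight a x" for x
    by (simp add: gen_hermite_weight_def abs_powr_def)
  ultimately show ?thesis by (simp add: is_weight_function_def)
qed

lemma closure_support_gen_hermite_weight:
  "closure (support_on UNIV (gen_hermite_weight a)) = (UNIV :: real set)"
proof -
  have "- {0} \<subseteq> support_on UNIV (gen_hermite_weight a)"
    by (auto simp: support_on_def gen_hermite_weight_eq gamma_weight_def)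
  hence "closure (- {0}) \<subseteq> closure (support_on UNIV (gen_hermite_weight a))"
    by (rule closure_mono)
  thus ?thesis by (auto simp: closure_complement)
qed

subsection \<open>The position operator\<close>

definition xhat_coeff :: "real \<Rightarrow> nat \<Rightarrow> real" where
  "xhat_coeff a n = sqrt (if even n then real (n div 2) + a else real (n div 2) + 1)"

lemma xhat_coeff_even: "xhat_coeff a (2 * k) = sqrt (real k + a)"
  and xhat_coeff_odd: "xhat_coeff a (Suc (2 * k)) = sqrt (real k + 1)"
  by (simp_all add: xhat_coeff_def)

lemma xhat_eq_jacobi_op: "xhat a = jacobi_op (xhat_coeff a)"
proof (intro ext)
  fix v n
  have raise: "raise_coeff a k = sqrt 2 * xhat_coeff a k" for k
    by (simp add: raise_coeff_def xhat_coeff_def real_sqrt_mult[symmetric])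
  have lower: "lower_coeff a (Suc k) = sqrt 2 * xhat_coeff a k" for k
    by (auto simp: lower_coeff_def xhat_coeff_def real_sqrt_mult[symmetric] add_ac)
  show "xhat a v n = jacobi_op (xhat_coeff a) v n"
    by (simp add: xhat_def b_plus_def b_minus_def jacobi_op_def raise lower add_divide_distrib)
qed

lemma xhat_coeff_regular:
  assumes a: "a > 0"
  shows "regular_jacobi (xhat_coeff a) (1 + a) (min a 1 / 2) (1 + a)"
proof
  have sq: "(xhat_coeff a n)\<^sup>2 = (if even n then real (n div 2) + a else real (n div 2) + 1)" for n
    using a by (simp add: xhat_coeff_def)
  fix n :: nat
  obtain k where n: "n = 2 * k \<or> n = Suc (2 * k)" by (metis oddE evenE Suc_eq_plus1)
  show "0 < xhat_coeff a n" using a by (simp add: xhat_coeff_def add_nonneg_pos)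
  have ak: "0 \<le> a * real k" using a by simp
  show "(xhat_coeff a n)\<^sup>2 \<le> (1 + a) * real (Suc n)"
    using n ak a unfolding sq by (auto simp: algebra_simps)
  show "0 < min a 1 / 2" using a by simp
  have mk: "min a 1 * real k \<le> real k" using a by (intro mult_left_le_one_le) auto
  show "min a 1 / 2 * real (Suc n) \<le> (xhat_coeff a n)\<^sup>2"
    using n mk a unfolding sq by (auto simp: algebra_simps)
  show "\<bar>(xhat_coeff a (Suc n))\<^sup>2 - (xhat_coeff a n)\<^sup>2\<bar> \<le> 1 + a"
    using n a unfolding sq by auto
qed

lemma xhat_domain_eq:
  assumes a: "a > 0"
  shows "xhat_domain a = {v \<in> ell2. xhat a v \<in> ell2}"
proof -
  interpret regular_jacobi "xhat_coeff a" "1 + a" "min a 1 / 2" "1 + a"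
    by (rule xhat_coeff_regular[OF a])
  show ?thesis
    using maximal_domain_core unfolding xhat_domain_def xhat_eq_jacobi_op by blast
qed

lemma xhat_spectrum:
  assumes a: "a > 0"
  shows "spectrum (xhat_domain a) (xhat a) = range complex_of_real"
proof -
  interpret regular_jacobi "xhat_coeff a" "1 + a" "min a 1 / 2" "1 + a"
    by (rule xhat_coeff_regular[OF a])
  let ?J = "jacobi_op (xhat_coeff a)"
  define D where "D = {v \<in> ell2. ?J v \<in> ell2}"
  have D: "xhat_domain a = D" "xhat a = ?J"
    unfolding D_def xhat_domain_eq[OF a] xhat_eq_jacobi_op by simp_all
  have shifted: "(\<lambda>n. ?J v n - z * v n) \<in> ell2" if "v \<in> D" for v z
    using that unfolding D_def by (auto intro!: ell2_diff ell2_scale)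
  have "z \<in> resolvent_set D ?J \<longleftrightarrow> Im z \<noteq> 0" for z
  proof
    assume z: "Im z \<noteq> 0"
    have bound: "ell2_norm v \<le> 1 / \<bar>Im z\<bar> * ell2_norm (\<lambda>n. ?J v n - z * v n)" if "v \<in> D" for v
      using lower_bound_nonreal[of v z] that shifted[OF that, of z] z by (simp add: D_def field_simps)
    have "inj_on (\<lambda>v n. ?J v n - z * v n) D"
    proof (rule inj_onI)
      fix u v assume u: "u \<in> D" and v: "v \<in> D"
        and eq: "(\<lambda>n. ?J u n - z * u n) = (\<lambda>n. ?J v n - z * v n)"
      define w where "w = (\<lambda>n. u n - v n)"
      have w0: "?J w n - z * w n = 0" for n
        using fun_cong[OF eq, of n] unfolding w_def jacobi_op_diff by (simp add: algebra_simps)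
      have w: "w \<in> ell2" using u v unfolding w_def D_def by (auto intro: ell2_diff)
      have "\<bar>Im z\<bar> * ell2_norm w \<le> ell2_norm (\<lambda>n. ?J w n - z * w n)"
        by (rule lower_bound_nonreal[OF w]) (simp add: w0 ell2_def)
      also have "\<dots> = 0" by (simp add: w0 ell2_norm_def)
      finally have "ell2_norm w = 0"
        using z ell2_norm_nonneg[OF w] by (simp add: mult_le_0_iff)
      thus "u = v" using ell2_norm_eq_0_D[OF w] by (auto simp: w_def)
    qed
    moreover have "(\<lambda>v n. ?J v n - z * v n) ` D = ell2"
    proof (intro equalityI subsetI)
      fix g assume g: "g \<in> ell2"
      obtain v where v: "v \<in> ell2" "\<And>n. ?J v n - z * v n = g n"
        using surjective_nonreal[OF z g] by blast
      have "?J v = (\<lambda>n. g n + z * v n)" using v(2) by (auto simp: fun_eq_iff algebra_simps)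
      hence "v \<in> D" using v(1) g by (auto simp: D_def intro: ell2_add ell2_scale)
      thus "g \<in> (\<lambda>v n. ?J v n - z * v n) ` D" using v(2) by (intro image_eqI[of _ _ v]) auto
    qed (use shifted in auto)
    ultimately show "z \<in> resolvent_set D ?J"
      using bound unfolding resolvent_set_def bij_betw_def by blast
  next
    assume z: "z \<in> resolvent_set D ?J"
    then obtain C where C: "\<And>v. v \<in> D \<Longrightarrow> ell2_norm v \<le> C * ell2_norm (\<lambda>n. ?J v n - z * v n)"
      unfolding resolvent_set_def by blast
    show "Im z \<noteq> 0"
    proof
      assume "Im z = 0"
      hence zr: "z = complex_of_real (Re z)" by (simp add: complex_eq_iff)
      obtain w where w: "w \<in> ell2" "(\<lambda>n. ?J w n - z * w n) \<in> ell2"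
        "C * ell2_norm (\<lambda>n. ?J w n - z * w n) < ell2_norm w"
        using approximate_eigenvector[of "Re z" C] unfolding zr[symmetric] by blast
      have "?J w \<in> ell2" using ell2_add[OF w(2) ell2_scale[OF w(1), of z]] by simp
      hence "w \<in> D" using w(1) by (simp add: D_def)
      from C[OF this] w(3) show False by simp
    qed
  qed
  hence "spectrum D ?J = {z. Im z = 0}" by (auto simp: spectrum_def)
  also have "\<dots> = range complex_of_real"
    by (auto simp: image_iff complex_eq_iff)
  finally show ?thesis unfolding D .
qed

lemma eigenseries_even: "eigenseries a x (2 * k) = complex_of_real (beta_even a k x)"
  and eigenseries_odd: "eigenseries a x (Suc (2 * k)) = complex_of_real (beta_odd a k x)"
  by (simp_all add: eigenseries_def)

lemma eigenseries_formal_eigenvector: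
  assumes a: "a > 0"
  shows "formal_eigenvector (xhat a) (complex_of_real x) (eigenseries a x)"
proof -
  define W where "W = abs_powr x (a - 1 / 2) * exp (- x\<^sup>2 / 2)"
  define A where "A k = sqrt (pochhammer a k / (fact k * Gamma a))" for k
  define F where "F k b = hyp1F1 k b (x\<^sup>2)" for k b
  have G: "Gamma a > 0" "Gamma (a + 1) = a * Gamma a"
    using a by (auto intro: Gamma_real_pos simp: Gamma_plus1 nonpos_Ints_def)
  have even_eq: "beta_even a k x = (- 1) ^ k * A k * W * F k a" for k
    by (simp add: beta_even_def A_def W_def F_def real_sqrt_divide real_sqrt_mult)
  have odd_eq: "beta_odd a k x = (- 1) ^ k * A k * (sqrt (real k + a) / a) * x * W * F k (a + 1)" for k
  proof -
    have "a * pochhammer (a + 1) k = (a + real k) * pochhammer a k"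
      using pochhammer_rec[of a k] pochhammer_rec'[of a k] by simp
    hence "pochhammer (a + 1) k = (real k + a) * pochhammer a k / a"
      using a by (simp add: field_simps)
    hence "pochhammer (a + 1) k / (fact k * Gamma (a + 1))
        = pochhammer a k / (fact k * Gamma a) * ((real k + a) / a\<^sup>2)"
      using G by (simp add: power2_eq_square mult_ac)
    hence "sqrt (pochhammer (a + 1) k / (fact k * Gamma (a + 1))) = A k * (sqrt (real k + a) / a)"
      using a by (simp add: A_def real_sqrt_mult real_sqrt_divide)
    moreover have "beta_odd a k x
        = (- 1) ^ k * sqrt (pochhammer (a + 1) k / (fact k * Gamma (a + 1))) * x * W * F k (a + 1)"
      by (simp add: beta_odd_def W_def F_def real_sqrt_divide real_sqrt_mult)
    ultimately show ?thesis by simp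
  qed
  have A_step: "sqrt (real k + 1) * A (Suc k) = sqrt (real k + a) * A k" for k
  proof -
    have fact_step: "fact (Suc k) = (real k + 1) * fact k" by simp
    have "real k + 1 \<noteq> 0" by linarith
    hence "(real k + 1) * (pochhammer a (Suc k) / (fact (Suc k) * Gamma a))
        = (real k + a) * (pochhammer a k / (fact k * Gamma a))"
      unfolding pochhammer_Suc fact_step by (simp add: add.commute)
    thus ?thesis unfolding A_def real_sqrt_mult[symmetric] by simp
  qed
  have even_rec: "sqrt (real k + a) * beta_odd a k x
      + (if k = 0 then 0 else sqrt (real k) * beta_odd a (k - 1) x) = x * beta_even a k x" for k
  proof -
    have top: "sqrt (real k + a) * beta_odd a k x = (- 1) ^ k * A k * x * W * ((a + real k) * F k (a + 1)) / a"
    proof -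
      have "sqrt (real k + a) * beta_odd a k x
          = (- 1) ^ k * A k * x * W * ((sqrt (real k + a) * sqrt (real k + a)) * F k (a + 1)) / a"
        unfolding odd_eq by simp
      thus ?thesis using a by (simp add: add.commute)
    qed
    have low: "(if k = 0 then 0 else sqrt (real k) * beta_odd a (k - 1) x)
        = - ((- 1) ^ k * A k * x * W * (real k * F (k - 1) (a + 1)) / a)"
    proof (cases k)
      case (Suc j)
      have "sqrt (real k) * beta_odd a j x
          = (- 1) ^ j * (sqrt (real j + a) * A j) * sqrt (real j + 1) * x * W * F j (a + 1) / a"
        unfolding odd_eq using Suc by (simp add: add.commute)
      also have "\<dots> = (- 1) ^ j * A k * x * W * ((sqrt (real j + 1) * sqrt (real j + 1)) * F j (a + 1)) / a"
        unfolding A_step[symmetric] Suc by simp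
      also have "\<dots> = (- 1) ^ j * A k * x * W * (real k * F j (a + 1)) / a"
        using Suc by (simp add: add.commute)
      finally show ?thesis using Suc by simp
    qed simp
    have "sqrt (real k + a) * beta_odd a k x + (if k = 0 then 0 else sqrt (real k) * beta_odd a (k - 1) x)
        = (- 1) ^ k * A k * x * W * ((a + real k) * F k (a + 1) - real k * F (k - 1) (a + 1)) / a"
      unfolding top low by (simp add: right_diff_distrib diff_divide_distrib)
    also have "(a + real k) * F k (a + 1) - real k * F (k - 1) (a + 1) = a * F k a"
      unfolding F_def by (rule hyp1F1_contiguous_param[OF a])
    finally show ?thesis using a by (simp add: even_eq)
  qed
  have odd_rec: "sqrt (real k + 1) * beta_even a (Suc k) x + sqrt (real k + a) * beta_even a k x
      = x * beta_odd a k x" for k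
  proof -
    have "sqrt (real k + 1) * beta_even a (Suc k) x + sqrt (real k + a) * beta_even a k x
        = - ((- 1) ^ k * (sqrt (real k + 1) * A (Suc k)) * W * F (Suc k) a)
          + (- 1) ^ k * (sqrt (real k + a) * A k) * W * F k a"
      unfolding even_eq by simp
    also have "\<dots> = (- 1) ^ k * (sqrt (real k + a) * A k) * W * (F k a - F (Suc k) a)"
      unfolding A_step by (simp add: algebra_simps)
    also have "F k a - F (Suc k) a = x\<^sup>2 / a * F k (a + 1)"
      unfolding F_def by (rule hyp1F1_contiguous_step[OF a])
    finally show ?thesis by (simp add: odd_eq power2_eq_square)
  qed
  show ?thesis
    unfolding formal_eigenvector_def xhat_eq_jacobi_op
  proof
    fix n
    obtain k where "n = 2 * k \<or> n = Suc (2 * k)" by (metis oddE evenE Suc_eq_plus1)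
    thus "jacobi_op (xhat_coeff a) (eigenseries a x) n = complex_of_real x * eigenseries a x n"
    proof
      assume n: "n = 2 * k"
      have "jacobi_op (xhat_coeff a) (eigenseries a x) n = complex_of_real (sqrt (real k + a) * beta_odd a k x
          + (if k = 0 then 0 else sqrt (real k) * beta_odd a (k - 1) x))"
      proof (cases k)
        case (Suc j)
        have "n = Suc (Suc (2 * j))" using n Suc by simp
        hence "jacobi_op (xhat_coeff a) (eigenseries a x) n
          = complex_of_real (xhat_coeff a (2 * k)) * eigenseries a x (Suc (2 * k))
            + complex_of_real (xhat_coeff a (Suc (2 * j))) * eigenseries a x (Suc (2 * j))"
          using Suc by (simp add: jacobi_op_Suc)
        thus ?thesis
          unfolding xhat_coeff_even xhat_coeff_odd eigenseries_odd using Suc by (simp add: add.commute)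
      qed (use n xhat_coeff_even[of a 0] eigenseries_odd[of a x 0] in \<open>simp add: jacobi_op_0\<close>)
      thus ?thesis unfolding even_rec n eigenseries_even by simp
    next
      assume n: "n = Suc (2 * k)"
      have "Suc (Suc (2 * k)) = 2 * Suc k" by simp
      hence "jacobi_op (xhat_coeff a) (eigenseries a x) n
          = complex_of_real (sqrt (real k + 1) * beta_even a (Suc k) x + sqrt (real k + a) * beta_even a k x)"
        unfolding n jacobi_op_Suc by (simp only: xhat_coeff_even xhat_coeff_odd eigenseries_even of_real_add of_real_mult)
      thus ?thesis unfolding odd_rec n eigenseries_odd by simp
    qed
  qed
qed

lemma eigenseries_nonzero:
  assumes "a > 0" "x \<noteq> 0 \<or> a = 1 / 2"
  shows "eigenseries a x 0 \<noteq> 0"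
proof -
  have "Gamma a \<noteq> 0" using Gamma_real_pos[OF assms(1)] by simp
  thus ?thesis
    using assms by (auto simp: eigenseries_def beta_even_def hyp1F1_def abs_powr_def)
qed

theorem theorem3:
  fixes a :: real
  assumes "a > 0"
  shows "(\<forall>x::real. formal_eigenvector (xhat a) (complex_of_real x) (eigenseries a x)) \<and>
         (\<forall>x::real. x \<noteq> 0 \<or> a = 1 / 2 \<longrightarrow> (\<exists>n. eigenseries a x n \<noteq> 0)) \<and>
         spectrum (xhat_domain a) (xhat a) = range complex_of_real \<and>
         is_weight_function (gen_hermite_weight a) (gen_hermite a) \<and>
         closure (support_on UNIV (gen_hermite_weight a)) = (UNIV :: real set)"
  using eigenseries_formal_eigenvector[OF assms] eigenseries_nonzero[OF assms] xhat_spectrum[OF assms]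
    gen_hermite_weight_function[OF assms] closure_support_gen_hermite_weight[of a] by blast

end
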